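(* For $A\in\mathbb{R}^{m\times n}$ define $\Phi_{m,n}(A)=\mathbb{E}_{u\sim\mathcal{S}^{m-1},\,v\sim\mathcal{S}^{n-1}}\left[e^{u^\top A v}\right]$, where $u$ and $v$ are independent and uniformly distributed on the Euclidean unit spheres $\mathcal{S}^{m-1}\subset\mathbb{R}^m$ and $\mathcal{S}^{n-1}\subset\mathbb{R}^n$. Then for any $A\in\mathbb{R}^{m\times n}$, any $\lambda\in\mathbb{R}$ and any $\varepsilon\in(0,1)$, $$\Phi_{m,n}(\lambda A)\ge (1-\varepsilon^2)^{\frac{m+n}{2}}\, e^{\varepsilon^2\|\lambda A\|},$$ where $\|\cdot\|$ denotes the operator norm (largest singular value).
   Context: $\mathcal{S}^{k-1}=\{x\in\mathbb{R}^k:\|x\|=1\}$ with the Euclidean norm; for $k=1$ this is $\{-1,1\}$ with the uniform distribution. *)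

theory Defs
  imports "HOL-Analysis.Analysis"
begin

text \<open>Uniform (normalised surface) probability measure on the unit sphere of real^'k,
  realised as the cone measure: the push-forward of the normalised Lebesgue measure
  on the closed unit ball under radial projection x \<mapsto> x / |x|.
  For k = 1 this is the uniform distribution on {-1, 1}.\<close>
definition sphere_unif :: "('k::finite) itself \<Rightarrow> (real ^ 'k) measure" where
  "sphere_unif _ = distr (uniform_measure lborel (cball 0 1)) borel (\<lambda>x. x /\<^sub>R norm x)"

text \<open>Phi_{m,n}(A) = E_{u,v} exp(u^T A v), u, v independent uniform on the spheres.\<close>
definition Phi :: "real ^ 'n ^ 'm \<Rightarrow> real" where
  "Phi A = integral\<^sup>L (sphere_unif TYPE('m) \<Otimes>\<^sub>M sphere_unif TYPE('n))
              (\<lambda>(u, v). exp (u \<bullet> (A *v v)))"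

end

(* Fix a unit vector b and write M = lam A. By Tonelli and Cauchy-Schwarz (u . M v = v . M^T u and
   u . M b <= |M^T u|), the theorem reduces to the one-sphere bound
     E exp (u . w) >= (1 - eps^2)^(k/2) exp (eps |w|)   for u uniform on S^(k-1),
   used first for the v-integral with w = M^T u and then for the u-integral with w = eps M b;
   maximising over b gives the operator norm.

   Expanding cosh and computing the even moments of u . a by integrating Gaussians in polar
   coordinates gives E exp (u . w) = G_k (|w|^2) with G_k z = sum_j z^j / (4^j j! (k/2)_j).
   F t = G_k (t^2) solves (t^(k-1) F')' = t^(k-1) F, so F'/F solves a Riccati equation, and comparison
   with an explicit subsolution gives ln F t >= max_eps (eps t + k/2 ln (1 - eps^2)). *)

theory Submission
  imports Defs "HOL-Probability.Probability"
begin

section \<open>The spherical moment generating function as a power series\<close>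

definition mgf_coeff :: "real \<Rightarrow> nat \<Rightarrow> real" where
  "mgf_coeff k j = 1 / (4 ^ j * fact j * pochhammer (k / 2) j)"

text \<open>The hypergeometric function 0F1(; k/2; z/4); \<open>sphere_mgf k \<parallel>w\<parallel>\<^sup>2\<close> turns out to be the moment
  generating function of the uniform distribution on the unit sphere of \<open>\<real>\<^sup>k\<close> at \<open>w\<close>.\<close>
definition sphere_mgf :: "real \<Rightarrow> real \<Rightarrow> real" where
  "sphere_mgf k z = (\<Sum>j. mgf_coeff k j * z ^ j)"

definition sphere_mgf' :: "real \<Rightarrow> real \<Rightarrow> real" where
  "sphere_mgf' k z = (\<Sum>j. diffs (mgf_coeff k) j * z ^ j)"

lemma power_le_pochhammer:
  fixes x :: real
  assumes "0 \<le> x"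
  shows "x ^ j \<le> pochhammer x j"
proof -
  have "x ^ j = (\<Prod>i<j. x)" by simp
  also have "\<dots> \<le> (\<Prod>i<j. x + of_nat i)"
    by (rule prod_mono) (use assms in auto)
  finally show ?thesis by (simp add: pochhammer_prod atLeast0LessThan)
qed

lemma mgf_coeff_pos: "k > 0 \<Longrightarrow> mgf_coeff k j > 0"
  unfolding mgf_coeff_def by (auto intro!: mult_pos_pos pochhammer_pos)

lemma mgf_coeff_le_inverse_fact:
  assumes "k \<ge> 1"
  shows "mgf_coeff k j \<le> inverse (fact j)"
proof -
  have "(1::real) \<le> 2 ^ j" by simp
  also have "(2::real) ^ j = 4 ^ j * (1/2) ^ j" by (simp add: power_mult_distrib[symmetric])
  also have "\<dots> \<le> 4 ^ j * pochhammer (k / 2) j"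
    using assms power_mono[of "1/2" "k/2" j] power_le_pochhammer[of "k/2" j] by simp
  finally show ?thesis
    unfolding mgf_coeff_def by (simp add: field_simps)
qed

lemma summable_mgf_coeff:
  assumes "k \<ge> 1"
  shows "summable (\<lambda>j. mgf_coeff k j * z ^ j)"
proof (rule summable_comparison_test[OF _ summable_exp[of "\<bar>z\<bar>"]])
  show "\<exists>N. \<forall>j\<ge>N. norm (mgf_coeff k j * z ^ j) \<le> inverse (fact j) * \<bar>z\<bar> ^ j"
    using mgf_coeff_le_inverse_fact[OF assms] mgf_coeff_pos[of k] assms
    by (auto simp: abs_mult power_abs less_imp_le intro!: mult_right_mono)
qed

lemma mgf_coeff_Suc:
  assumes "k > 0"
  shows "mgf_coeff k (Suc j) * (4 * (real j + 1) * (k / 2 + real j)) = mgf_coeff k j"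
proof -
  have "pochhammer (k / 2) j > 0" "k / 2 + real j > 0" using assms by (auto intro: pochhammer_pos)
  then show ?thesis
    unfolding mgf_coeff_def pochhammer_Suc fact_Suc power_Suc by (simp add: divide_simps)
qed

lemma sphere_mgf_0 [simp]: "sphere_mgf k 0 = 1"
  unfolding sphere_mgf_def using powser_zero[of "mgf_coeff k"] by (simp add: mgf_coeff_def)

lemma sphere_mgf_ge_1:
  assumes "k \<ge> 1" "z \<ge> 0"
  shows "1 \<le> sphere_mgf k z"
proof -
  have "(\<Sum>j<1. mgf_coeff k j * z ^ j) \<le> sphere_mgf k z"
    unfolding sphere_mgf_def using assms mgf_coeff_pos[of k]
    by (intro sum_le_suminf summable_mgf_coeff) (auto simp: less_imp_le)
  then show ?thesis by (simp add: mgf_coeff_def)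
qed

lemma sphere_mgf_has_derivative:
  "k \<ge> 1 \<Longrightarrow> (sphere_mgf k has_real_derivative sphere_mgf' k z) (at z)"
  unfolding sphere_mgf_def[abs_def] sphere_mgf'_def
  by (intro termdiffs_strong_converges_everywhere summable_mgf_coeff)

lemma sphere_mgf'_has_derivative:
  "k \<ge> 1 \<Longrightarrow> (sphere_mgf' k has_real_derivative (\<Sum>j. diffs (diffs (mgf_coeff k)) j * z ^ j)) (at z)"
  unfolding sphere_mgf'_def[abs_def]
  by (intro termdiffs_strong_converges_everywhere termdiff_converges_all summable_mgf_coeff)

lemma sphere_mgf_ode:
  assumes k: "k \<ge> 1"
  shows "2 * k * sphere_mgf' k z + 4 * z * (\<Sum>j. diffs (diffs (mgf_coeff k)) j * z ^ j) = sphere_mgf k z"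
proof -
  define c where "c = mgf_coeff k"
  define f where "f j = real j * diffs c j * z ^ j" for j
  have sums_c: "(\<lambda>j. c j * z ^ j) sums sphere_mgf k z"
    unfolding sphere_mgf_def c_def using summable_mgf_coeff[OF k] by (rule summable_sums)
  have sums_c': "(\<lambda>j. diffs c j * z ^ j) sums sphere_mgf' k z"
    unfolding sphere_mgf'_def c_def using summable_mgf_coeff[OF k]
    by (intro summable_sums termdiff_converges_all)
  have "(\<lambda>j. diffs (diffs c) j * z ^ j) sums (\<Sum>j. diffs (diffs c) j * z ^ j)"
    unfolding c_def using summable_mgf_coeff[OF k]
    by (intro summable_sums termdiff_converges_all)
  moreover have "(\<lambda>j. f (Suc j)) = (\<lambda>j. z * (diffs (diffs c) j * z ^ j))"
    by (simp add: fun_eq_iff f_def diffs_def algebra_simps)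
  ultimately have "(\<lambda>j. f (Suc j)) sums (z * (\<Sum>j. diffs (diffs c) j * z ^ j))"
    by (simp add: sums_mult)
  then have sums_f: "f sums (z * (\<Sum>j. diffs (diffs c) j * z ^ j))"
    by (subst (asm) sums_Suc_iff) (simp add: f_def)
  have "(\<lambda>j. 2 * k * (diffs c j * z ^ j) + 4 * f j) sums
          (2 * k * sphere_mgf' k z + 4 * (z * (\<Sum>j. diffs (diffs c) j * z ^ j)))"
    by (intro sums_add sums_mult sums_c' sums_f)
  moreover have "2 * k * (diffs c j * z ^ j) + 4 * f j = c j * z ^ j" for j
  proof -
    have "2 * k * (diffs c j * z ^ j) + 4 * f j
        = c (Suc j) * (4 * (real j + 1) * (k / 2 + real j)) * z ^ j"
      by (simp add: f_def diffs_def algebra_simps)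
    then show ?thesis using mgf_coeff_Suc[of k j] k by (simp add: c_def)
  qed
  ultimately show ?thesis
    using sums_unique2[OF _ sums_c] by (simp add: c_def)
qed

lemma sphere_mgf_square_has_derivative:
  "k \<ge> 1 \<Longrightarrow> ((\<lambda>t. sphere_mgf k (t\<^sup>2)) has_real_derivative 2 * t * sphere_mgf' k (t\<^sup>2)) (at t)"
  by (rule DERIV_chain2[OF sphere_mgf_has_derivative, THEN DERIV_cong])
     (auto intro!: derivative_eq_intros)

text \<open>The radial form of \<open>\<Delta>f = f\<close> for \<open>f x = sphere_mgf k \<parallel>x\<parallel>\<^sup>2\<close> on \<open>\<real>\<^sup>k\<close>, \<open>k = n + 1\<close>.\<close>
lemma sphere_mgf_radial_ode:
  "((\<lambda>t. t ^ n * (2 * t * sphere_mgf' (Suc n) (t\<^sup>2))) has_real_derivative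
     t ^ n * sphere_mgf (Suc n) (t\<^sup>2)) (at t)"
proof -
  define k where "k = real (Suc n)"
  have k: "k \<ge> 1" by (simp add: k_def)
  let ?G2 = "\<lambda>z. \<Sum>j. diffs (diffs (mgf_coeff k)) j * z ^ j"
  have "((\<lambda>t. sphere_mgf' k (t\<^sup>2)) has_real_derivative ?G2 (t\<^sup>2) * (2 * t)) (at t)"
    by (rule DERIV_chain2[OF sphere_mgf'_has_derivative[OF k]]) (auto intro!: derivative_eq_intros)
  moreover have "((\<lambda>t. t ^ Suc n) has_real_derivative k * t ^ n) (at t)"
    using DERIV_pow[of "Suc n" t] by (simp add: k_def)
  ultimately have "((\<lambda>t. 2 * (t ^ Suc n * sphere_mgf' k (t\<^sup>2))) has_real_derivative
      2 * (k * t ^ n * sphere_mgf' k (t\<^sup>2) + ?G2 (t\<^sup>2) * (2 * t) * t ^ Suc n)) (at t)"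
    by (intro DERIV_cmult DERIV_mult)
  also have "2 * (k * t ^ n * sphere_mgf' k (t\<^sup>2) + ?G2 (t\<^sup>2) * (2 * t) * t ^ Suc n)
      = t ^ n * (2 * k * sphere_mgf' k (t\<^sup>2) + 4 * t\<^sup>2 * ?G2 (t\<^sup>2))"
    by (simp add: algebra_simps power2_eq_square)
  also have "\<dots> = t ^ n * sphere_mgf k (t\<^sup>2)"
    by (simp add: sphere_mgf_ode[OF k])
  finally show ?thesis
    by (simp add: k_def algebra_simps)
qed

section \<open>A lower bound by Riccati comparison\<close>

text \<open>\<open>tilt k t\<close> maximises \<open>\<epsilon> \<mapsto> \<epsilon> t + k/2 ln (1 - \<epsilon>\<^sup>2)\<close> (the stationarity condition is
  \<open>t (1 - \<epsilon>\<^sup>2) = k \<epsilon>\<close>), and \<open>mgf_exponent k t\<close> is the maximum.\<close>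
definition tilt :: "real \<Rightarrow> real \<Rightarrow> real" where
  "tilt k t = 2 * t / (k + sqrt (k\<^sup>2 + 4 * t\<^sup>2))"

definition mgf_exponent :: "real \<Rightarrow> real \<Rightarrow> real" where
  "mgf_exponent k t = t * tilt k t + k / 2 * ln (1 - (tilt k t)\<^sup>2)"

lemma tilt_0 [simp]: "tilt k 0 = 0"
  by (simp add: tilt_def)

lemma one_minus_tilt_sq:
  assumes "k > 0"
  shows "1 - (tilt k t)\<^sup>2 = 2 * k / (k + sqrt (k\<^sup>2 + 4 * t\<^sup>2))"
proof -
  define s where "s = sqrt (k\<^sup>2 + 4 * t\<^sup>2)"
  have "s\<^sup>2 = k\<^sup>2 + 4 * t\<^sup>2" by (simp add: s_def)
  then have num: "(k + s)\<^sup>2 - (2 * t)\<^sup>2 = 2 * k * (k + s)"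
    by (simp add: power2_eq_square algebra_simps)
  have pos: "k + s > 0" using assms by (simp add: s_def add_pos_nonneg)
  have "1 - (2 * t / (k + s))\<^sup>2 = ((k + s)\<^sup>2 - (2 * t)\<^sup>2) / (k + s)\<^sup>2"
    using pos by (simp add: power_divide diff_divide_distrib)
  also have "\<dots> = 2 * k / (k + s)"
    unfolding num using pos by (simp add: power2_eq_square)
  finally show ?thesis unfolding tilt_def s_def .
qed

lemma tilt_sq_less_1:
  assumes "k > 0"
  shows "(tilt k t)\<^sup>2 < 1"
proof -
  have "0 < 2 * k / (k + sqrt (k\<^sup>2 + 4 * t\<^sup>2))"
    using assms by (intro divide_pos_pos add_pos_nonneg) auto
  then show ?thesis using one_minus_tilt_sq[OF assms, of t] by linarith
qed

lemma tilt_stationary: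
  assumes "k > 0"
  shows "t * (1 - (tilt k t)\<^sup>2) = k * tilt k t"
proof -
  have "t * (1 - (tilt k t)\<^sup>2) = t * (2 * k / (k + sqrt (k\<^sup>2 + 4 * t\<^sup>2)))"
    by (simp only: one_minus_tilt_sq[OF assms])
  also have "\<dots> = k * tilt k t"
    by (simp add: tilt_def divide_inverse ac_simps)
  finally show ?thesis .
qed

lemma tilt_has_derivative:
  assumes "k > 0"
  shows "(tilt k has_real_derivative
           2 * k / (sqrt (k\<^sup>2 + 4 * t\<^sup>2) * (k + sqrt (k\<^sup>2 + 4 * t\<^sup>2)))) (at t)"
proof -
  define s where "s x = sqrt (k\<^sup>2 + 4 * x\<^sup>2)" for x
  have s: "s t > 0" "(s t)\<^sup>2 = k\<^sup>2 + 4 * t\<^sup>2" "k + s t > 0"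
    using assms by (simp_all add: s_def add_pos_nonneg)
  have "(s has_real_derivative inverse (s t) / 2 * (4 * (2 * t))) (at t)"
    using s(1) unfolding s_def[abs_def] by (auto intro!: derivative_eq_intros simp: power2_eq_square)
  then have ds: "(s has_real_derivative 4 * t / s t) (at t)"
    by (rule DERIV_cong) (simp add: field_simps)
  have "tilt k = (\<lambda>x. 2 * x / (k + s x))"
    by (simp add: fun_eq_iff tilt_def s_def)
  then have "(tilt k has_real_derivative (2 * (k + s t) - 2 * t * (4 * t / s t)) / (k + s t)\<^sup>2) (at t)"
    using s(3) by (auto intro!: derivative_eq_intros ds simp: power2_eq_square)
  also have "(2 * (k + s t) - 2 * t * (4 * t / s t)) / (k + s t)\<^sup>2 = 2 * k / (s t * (k + s t))"
    using s by (simp add: divide_simps power2_eq_square) (simp add: algebra_simps)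
  finally show ?thesis by (simp add: s_def)
qed

text \<open>The envelope theorem: the derivative of the maximum is the maximiser.\<close>
lemma mgf_exponent_has_derivative:
  assumes "k > 0"
  shows "(mgf_exponent k has_real_derivative tilt k t) (at t)"
proof -
  obtain e' where e': "(tilt k has_real_derivative e') (at t)"
    using tilt_has_derivative[OF assms] by blast
  have pos: "1 - (tilt k t)\<^sup>2 > 0" using tilt_sq_less_1[OF assms] by simp
  have "((\<lambda>x. 1 - (tilt k x)\<^sup>2) has_real_derivative - (2 * tilt k t * e')) (at t)"
    by (auto intro!: derivative_eq_intros e')
  then have "((\<lambda>x. ln (1 - (tilt k x)\<^sup>2)) has_real_derivative
      1 / (1 - (tilt k t)\<^sup>2) * - (2 * tilt k t * e')) (at t)"
    by (rule DERIV_chain2[where g = "\<lambda>x. 1 - (tilt k x)\<^sup>2", OF DERIV_ln_divide[OF pos]])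
  then have "(mgf_exponent k has_real_derivative
      1 * tilt k t + e' * t + k / 2 * (1 / (1 - (tilt k t)\<^sup>2) * - (2 * tilt k t * e'))) (at t)"
    unfolding mgf_exponent_def[abs_def] by (intro DERIV_add DERIV_mult DERIV_cmult DERIV_ident e')
  also have "1 * tilt k t + e' * t + k / 2 * (1 / (1 - (tilt k t)\<^sup>2) * - (2 * tilt k t * e'))
      = tilt k t + (t - k * tilt k t / (1 - (tilt k t)\<^sup>2)) * e'"
    using pos by (simp add: field_simps)
  also have "k * tilt k t / (1 - (tilt k t)\<^sup>2) = t"
    using tilt_stationary[OF assms, of t] pos by (auto simp: divide_eq_eq)
  finally show ?thesis by simp
qed

lemma mgf_exponent_0 [simp]: "mgf_exponent k 0 = 0"
  by (simp add: mgf_exponent_def)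

lemma le_mgf_exponent:
  assumes "k > 0" and "\<bar>\<epsilon>\<bar> < 1"
  shows "\<epsilon> * t + k / 2 * ln (1 - \<epsilon>\<^sup>2) \<le> mgf_exponent k t"
proof -
  define e where "e = tilt k t"
  have e: "1 - e\<^sup>2 > 0" using tilt_sq_less_1[OF assms(1)] by (simp add: e_def)
  have \<epsilon>: "1 - \<epsilon>\<^sup>2 > 0" using assms(2) by (simp add: abs_square_less_1)
  have "ln (1 - \<epsilon>\<^sup>2) - ln (1 - e\<^sup>2) = ln ((1 - \<epsilon>\<^sup>2) / (1 - e\<^sup>2))"
    using e \<epsilon> by (simp add: ln_div)
  also have "\<dots> \<le> (1 - \<epsilon>\<^sup>2) / (1 - e\<^sup>2) - 1"
    using e \<epsilon> by (intro ln_le_minus_one) simp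
  also have "\<dots> = (e\<^sup>2 - \<epsilon>\<^sup>2) / (1 - e\<^sup>2)"
    using e by (simp add: field_simps)
  also have "\<dots> \<le> 2 * e * (e - \<epsilon>) / (1 - e\<^sup>2)"
    using e sum_power2_ge_zero[of "e - \<epsilon>" 0]
    by (intro divide_right_mono) (auto simp: power2_eq_square algebra_simps)
  finally have "k / 2 * (ln (1 - \<epsilon>\<^sup>2) - ln (1 - e\<^sup>2)) \<le> k * e / (1 - e\<^sup>2) * (e - \<epsilon>)"
    using assms(1) by (auto dest: mult_left_mono[of _ _ "k / 2"])
  also have "k * e / (1 - e\<^sup>2) = t"
    using tilt_stationary[OF assms(1), of t] e by (simp add: e_def field_simps)
  finally show ?thesis
    unfolding mgf_exponent_def e_def[symmetric] by (simp add: algebra_simps)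
qed

text \<open>The Riccati equation \<open>y' = 1 - y\<^sup>2 - (k - 1) y / t\<close> is the one satisfied by the logarithmic
  derivative of \<open>t \<mapsto> sphere_mgf k (t\<^sup>2)\<close>.\<close>
lemma tilt_riccati:
  assumes k: "k \<ge> 1" and t: "t > 0" and e': "(tilt k has_real_derivative e') (at t)"
  shows "e' + (tilt k t)\<^sup>2 + (k - 1) * tilt k t / t \<le> 1"
proof -
  define s where "s = sqrt (k\<^sup>2 + 4 * t\<^sup>2)"
  have s: "s \<ge> k" "s > 0" "k + s > 0" using k by (auto simp: s_def real_le_rsqrt add_pos_nonneg)
  have "e' = 2 * k / (s * (k + s))"
    using DERIV_unique[OF e' tilt_has_derivative] k by (simp add: s_def)
  moreover have "1 - (tilt k t)\<^sup>2 = 2 * k / (k + s)"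
    using one_minus_tilt_sq[of k t] k by (simp add: s_def)
  moreover have "tilt k t / t = 2 / (k + s)"
    using t by (simp add: tilt_def s_def)
  ultimately have "1 - (e' + (tilt k t)\<^sup>2 + (k - 1) * (tilt k t / t))
      = 2 * k / (k + s) - (k - 1) * (2 / (k + s)) - 2 * k / (s * (k + s))"
    by (simp only: diff_add_eq_diff_diff_swap diff_diff_eq[symmetric])
  also have "\<dots> = 2 / (k + s) - 2 * k / (s * (k + s))"
    by (simp add: divide_inverse algebra_simps)
  also have "\<dots> = 2 * s / (s * (k + s)) - 2 * k / (s * (k + s))"
    using s by simp
  also have "\<dots> = 2 * (s - k) / (s * (k + s))"
    by (simp add: diff_divide_distrib algebra_simps)
  also have "\<dots> \<ge> 0" using s k by simp
  finally show ?thesis by simp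
qed

lemma DERIV_nonneg_imp_le:
  fixes f :: "real \<Rightarrow> real"
  assumes "a \<le> b" and "\<And>x. (f has_real_derivative f' x) (at x)" and "\<And>x. a < x \<Longrightarrow> x < b \<Longrightarrow> f' x \<ge> 0"
  shows "f a \<le> f b"
  using assms DERIV_isCont[OF assms(2)]
  by (intro DERIV_nonneg_imp_increasing_open[of a b f] continuous_at_imp_continuous_on) auto

text \<open>The function \<open>Q = exp H \<cdot> x\<^sup>n (F' - e F)\<close> vanishes at 0, and \<open>Q'\<close> is \<open>exp H \<cdot> x\<^sup>n F\<close> times the
  Riccati defect \<open>1 - e\<^sup>2 - n e / x - e'\<close> of \<open>e\<close>.\<close>
lemma radial_riccati_comparison:
  fixes n :: nat and F F' e e' H :: "real \<Rightarrow> real"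
  assumes dF: "\<And>x. (F has_real_derivative F' x) (at x)"
    and dP: "\<And>x. ((\<lambda>x. x ^ n * F' x) has_real_derivative x ^ n * F x) (at x)"
    and de: "\<And>x. (e has_real_derivative e' x) (at x)"
    and dH: "\<And>x. (H has_real_derivative e x) (at x)"
    and subsolution: "\<And>x. x > 0 \<Longrightarrow> e' x + (e x)\<^sup>2 + real n * e x / x \<le> 1"
    and F_nonneg: "\<And>x. x > 0 \<Longrightarrow> F x \<ge> 0"
    and at_0: "F' 0 = 0" "e 0 = 0"
    and t: "t > 0"
  shows "e t * F t \<le> F' t"
proof -
  define P where "P x = x ^ n * F' x" for x
  define R where "R x = x ^ n * e x * F x" for x
  define R' where "R' x = (real n * x ^ (n - 1) * e x + x ^ n * e' x) * F x + x ^ n * e x * F' x" for x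
  define Q where "Q x = exp (H x) * (P x - R x)" for x
  define Q' where "Q' x = exp (H x) * (e x * (P x - R x) + (x ^ n * F x - R' x))" for x
  have dR: "(R has_real_derivative R' x) (at x)" for x
    unfolding R_def[abs_def] R'_def by (auto intro!: derivative_eq_intros de dF simp: algebra_simps)
  have dQ: "(Q has_real_derivative Q' x) (at x)" for x
    unfolding Q_def[abs_def] Q'_def
    by (auto intro!: derivative_eq_intros dH dR dP[folded P_def] simp: algebra_simps)
  have Q'_nonneg: "Q' x \<ge> 0" if x: "x > 0" for x
  proof -
    have "Q' x = exp (H x) * x ^ n * F x * (1 - (e' x + (e x)\<^sup>2 + real n * e x / x))"
      using x by (cases n) (simp_all add: Q'_def P_def R_def R'_def field_simps power2_eq_square)
    then show ?thesis
      using subsolution[OF x] F_nonneg[OF x] x by simp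
  qed
  have "Q 0 \<le> Q t"
    by (rule DERIV_nonneg_imp_le[OF _ dQ]) (use t Q'_nonneg in auto)
  then have "0 \<le> exp (H t) * t ^ n * (F' t - e t * F t)"
    using at_0 by (simp add: Q_def P_def R_def algebra_simps)
  moreover have "0 < exp (H t) * t ^ n"
    using t by simp
  ultimately show ?thesis
    by (auto simp: zero_le_mult_iff)
qed

lemma tilt_le_log_deriv_sphere_mgf:
  assumes "t > 0"
  shows "tilt (Suc n) t * sphere_mgf (Suc n) (t\<^sup>2) \<le> 2 * t * sphere_mgf' (Suc n) (t\<^sup>2)"
proof -
  define k where "k = real (Suc n)"
  have k: "k \<ge> 1" by (simp add: k_def)
  define e' where "e' x = 2 * k / (sqrt (k\<^sup>2 + 4 * x\<^sup>2) * (k + sqrt (k\<^sup>2 + 4 * x\<^sup>2)))" for x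
  have de: "(tilt k has_real_derivative e' x) (at x)" for x
    unfolding e'_def using k by (intro tilt_has_derivative) simp
  have "tilt k t * sphere_mgf k (t\<^sup>2) \<le> 2 * t * sphere_mgf' k (t\<^sup>2)"
  proof (rule radial_riccati_comparison[where F = "\<lambda>x. sphere_mgf k (x\<^sup>2)"
        and F' = "\<lambda>x. 2 * x * sphere_mgf' k (x\<^sup>2)" and e = "tilt k" and H = "mgf_exponent k" and n = n])
    show "e' x + (tilt k x)\<^sup>2 + real n * tilt k x / x \<le> 1" if "x > 0" for x
      using tilt_riccati[OF k that de] by (simp add: k_def)
    show "sphere_mgf k (x\<^sup>2) \<ge> 0" for x
      using sphere_mgf_ge_1[OF k, of "x\<^sup>2"] by simp
    show "((\<lambda>x. x ^ n * (2 * x * sphere_mgf' k (x\<^sup>2))) has_real_derivative x ^ n * sphere_mgf k (x\<^sup>2)) (at x)"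
      for x unfolding k_def by (rule sphere_mgf_radial_ode)
  qed (use assms k de sphere_mgf_square_has_derivative mgf_exponent_has_derivative in auto)
  then show ?thesis by (simp add: k_def)
qed

lemma exp_mgf_exponent_le_sphere_mgf:
  assumes "t \<ge> 0"
  shows "exp (mgf_exponent (Suc n) t) \<le> sphere_mgf (Suc n) (t\<^sup>2)"
proof -
  define k where "k = real (Suc n)"
  have k: "k \<ge> 1" by (simp add: k_def)
  define D where "D x = sphere_mgf k (x\<^sup>2) * exp (- mgf_exponent k x)" for x
  define D' where "D' x = exp (- mgf_exponent k x) * (2 * x * sphere_mgf' k (x\<^sup>2) - tilt k x * sphere_mgf k (x\<^sup>2))" for x
  have dD: "(D has_real_derivative D' x) (at x)" for x
    unfolding D_def[abs_def] D'_def using k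
    by (auto intro!: derivative_eq_intros sphere_mgf_square_has_derivative mgf_exponent_has_derivative
             simp: algebra_simps)
  have D'_nonneg: "D' x \<ge> 0" if "x > 0" for x
    using tilt_le_log_deriv_sphere_mgf[OF that, of n] by (simp add: D'_def k_def)
  have "D 0 \<le> D t"
    by (rule DERIV_nonneg_imp_le[OF _ dD]) (use assms D'_nonneg in auto)
  then show ?thesis
    by (simp add: D_def k_def exp_minus field_simps)
qed

lemma sphere_mgf_lower_bound:
  assumes "\<bar>\<epsilon>\<bar> < 1" and "t \<ge> 0"
  shows "(1 - \<epsilon>\<^sup>2) powr (real (Suc n) / 2) * exp (\<epsilon> * t) \<le> sphere_mgf (Suc n) (t\<^sup>2)"
proof -
  have "1 - \<epsilon>\<^sup>2 > 0" using assms(1) by (simp add: abs_square_less_1)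
  then have "(1 - \<epsilon>\<^sup>2) powr (real (Suc n) / 2) * exp (\<epsilon> * t)
      = exp (\<epsilon> * t + real (Suc n) / 2 * ln (1 - \<epsilon>\<^sup>2))"
    by (simp add: powr_def exp_add mult.commute)
  also have "\<dots> \<le> exp (mgf_exponent (Suc n) t)"
    using le_mgf_exponent[OF _ assms(1)] by simp
  also have "\<dots> \<le> sphere_mgf (Suc n) (t\<^sup>2)"
    using exp_mgf_exponent_le_sphere_mgf[OF assms(2)] .
  finally show ?thesis .
qed

section \<open>Polar coordinates\<close>

lemma measure_eqI_Iio:
  fixes M N :: "real measure"
  assumes sets: "sets M = sets borel" "sets N = sets borel"
    and fin: "\<And>x. emeasure M {..<x} < \<infinity>"
    and eq: "\<And>x. emeasure M {..<x} = emeasure N {..<x}"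
  shows "M = N"
proof (rule measure_eqI_generator_eq_countable)
  let ?E = "range lessThan :: real set set"
  show "Int_stable ?E"
  proof (rule Int_stableI)
    fix A B assume "A \<in> ?E" "B \<in> ?E"
    then obtain a b where "A = {..<a}" "B = {..<b}" by auto
    moreover have "{..<a} \<inter> {..<b} = {..<min a b}" by auto
    ultimately show "A \<inter> B \<in> ?E" by auto
  qed
  show "?E \<subseteq> Pow UNIV" "sets M = sigma_sets UNIV ?E" "sets N = sigma_sets UNIV ?E"
    unfolding sets borel_Iio by auto
  show "(\<Union>q\<in>\<rat>. {..<q}) = (UNIV :: real set)"
  proof (intro set_eqI iffI)
    fix x :: real
    obtain q where "q \<in> \<rat>" "x + 1 \<le> q" using Rats_no_top_le by blast
    then show "x \<in> (\<Union>q\<in>\<rat>. {..<q})" by (intro UN_I[of q]) auto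
  qed auto
  show "lessThan ` \<rat> \<subseteq> ?E" "\<And>A. A \<in> lessThan ` \<rat> \<Longrightarrow> emeasure M A \<noteq> \<infinity>"
    using fin by (auto simp: less_top)
qed (auto intro: eq countable_rat)

lemma nn_integral_lborel_scaleR:
  fixes f :: "'a::euclidean_space \<Rightarrow> ennreal"
  assumes [measurable]: "f \<in> borel_measurable borel" and "c \<noteq> 0"
  shows "(\<integral>\<^sup>+x. f x \<partial>lborel) = ennreal (\<bar>c\<bar> ^ DIM('a)) * (\<integral>\<^sup>+x. f (c *\<^sub>R x) \<partial>lborel)"
proof -
  have "(\<integral>\<^sup>+x. f x \<partial>lborel)
      = (\<integral>\<^sup>+x. f x \<partial>density (distr lborel borel (\<lambda>x. 0 + c *\<^sub>R x)) (\<lambda>_. \<bar>c\<bar> ^ DIM('a)))"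
    by (subst lborel_affine[OF assms(2), symmetric]) (rule refl)
  also have "\<dots> = (\<integral>\<^sup>+x. ennreal (\<bar>c\<bar> ^ DIM('a)) * f (c *\<^sub>R x) \<partial>lborel)"
    by (simp add: nn_integral_density nn_integral_distr)
  also have "\<dots> = ennreal (\<bar>c\<bar> ^ DIM('a)) * (\<integral>\<^sup>+x. f (c *\<^sub>R x) \<partial>lborel)"
    by (rule nn_integral_cmult) measurable
  finally show ?thesis .
qed

lemma nn_integral_ball_scale:
  fixes h :: "'a::euclidean_space \<Rightarrow> ennreal"
  assumes [measurable]: "h \<in> borel_measurable borel"
    and scale_inv: "\<And>c x. c > 0 \<Longrightarrow> h (c *\<^sub>R x) = h x" and R: "R > 0"
  shows "(\<integral>\<^sup>+x. h x * indicator (ball 0 R) x \<partial>lborel)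
       = ennreal (R ^ DIM('a)) * (\<integral>\<^sup>+x. h x * indicator (ball 0 1) x \<partial>lborel)"
proof -
  have "R *\<^sub>R x \<in> ball 0 R \<longleftrightarrow> x \<in> ball (0::'a) 1" for x
    using R by (simp add: dist_norm)
  then show ?thesis
    using R by (subst nn_integral_lborel_scaleR[of _ R]) (auto simp: scale_inv indicator_def)
qed

lemma nn_integral_power_lessThan:
  assumes "R > 0" and "D \<ge> 1"
  shows "(\<integral>\<^sup>+r. ennreal (real D * r ^ (D - 1)) * indicator {0..} r * indicator {..<R} r \<partial>lborel)
       = ennreal (R ^ D)"
proof -
  have "AE r in lborel. r \<noteq> R" by (rule AE_lborel_singleton)
  then have "(\<integral>\<^sup>+r. ennreal (real D * r ^ (D - 1)) * indicator {0..} r * indicator {..<R} r \<partial>lborel)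
      = (\<integral>\<^sup>+r. ennreal (indicator {0..R} r * (real D * r ^ (D - 1))) \<partial>lborel)"
    by (intro nn_integral_cong_AE) (auto elim!: eventually_mono simp: indicator_def)
  also have "\<dots> = ennreal (R ^ D - 0 ^ D)"
  proof (rule nn_integral_has_integral_lborel)
    have "((\<lambda>r. real D * r ^ (D - 1)) has_integral (R ^ D - 0 ^ D)) {0..R}"
      using assms by (intro fundamental_theorem_of_calculus)
        (auto intro!: derivative_eq_intros simp: has_real_derivative_iff_has_vector_derivative[symmetric])
    then have "((\<lambda>r. indicator {0..R} r * (real D * r ^ (D - 1))) has_integral (R ^ D - 0 ^ D)) {0..R}"
      by (subst has_integral_cong[where g="\<lambda>r. real D * r ^ (D - 1)"]) auto
    then show "((\<lambda>r. indicator {0..R} r * (real D * r ^ (D - 1))) has_integral (R ^ D - 0 ^ D)) UNIV"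
      by (intro has_integral_on_superset[where T=UNIV and S="{0..R}"]) auto
  qed (auto simp: indicator_def)
  finally show ?thesis using assms by (simp add: power_0_left)
qed

text \<open>By scaling, the distribution function of the push-forward is \<open>r \<mapsto> r\<^sup>D \<integral>\<^sub>B h\<close>.\<close>
lemma distr_norm_density_scale_invariant:
  fixes h :: "'a::euclidean_space \<Rightarrow> ennreal"
  assumes h[measurable]: "h \<in> borel_measurable borel"
    and scale_inv: "\<And>c x. c > 0 \<Longrightarrow> h (c *\<^sub>R x) = h x"
    and bounded: "\<And>x. h x \<le> ennreal B"
  shows "distr (density lborel h) borel norm = density lborel
           (\<lambda>r. (\<integral>\<^sup>+x. h x * indicator (ball 0 1) x \<partial>lborel)
                  * (ennreal (real DIM('a) * r ^ (DIM('a) - 1)) * indicator {0..} r))"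
    (is "?\<nu> = density lborel (\<lambda>r. ?I * ?\<rho> r)")
proof (rule measure_eqI_Iio)
  have D: "DIM('a) \<ge> 1" by (simp add: DIM_positive Suc_leI)
  have \<nu>_lessThan: "emeasure ?\<nu> {..<R} = (\<integral>\<^sup>+x. h x * indicator (ball 0 R) x \<partial>lborel)" for R
  proof -
    have "norm -` {..<R} \<inter> space (density lborel h) = ball 0 R" by (auto simp: dist_norm)
    then show ?thesis by (subst emeasure_distr) (auto simp: emeasure_density)
  qed
  show "sets ?\<nu> = sets borel" "sets (density lborel (\<lambda>r. ?I * ?\<rho> r)) = sets borel" by simp_all
  fix R :: real
  have "(\<integral>\<^sup>+x. h x * indicator (ball 0 R) x \<partial>lborel)
      \<le> (\<integral>\<^sup>+x. ennreal B * indicator (cball (0::'a) \<bar>R\<bar>) x \<partial>lborel)"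
    using bounded by (intro nn_integral_mono) (auto simp: indicator_def)
  also have "\<dots> = ennreal B * emeasure lborel (cball (0::'a) \<bar>R\<bar>)"
    by (rule nn_integral_cmult_indicator) simp
  also have "\<dots> < \<infinity>"
    using emeasure_lborel_cball_finite[of "0::'a" "\<bar>R\<bar>"] by (simp add: ennreal_mult_less_top)
  finally show "emeasure ?\<nu> {..<R} < \<infinity>" by (simp add: \<nu>_lessThan)
  have "emeasure (density lborel (\<lambda>r. ?I * ?\<rho> r)) {..<R} = ?I * (\<integral>\<^sup>+r. ?\<rho> r * indicator {..<R} r \<partial>lborel)"
    by (subst emeasure_density) (auto simp: mult.assoc intro!: nn_integral_cmult)
  also have "\<dots> = emeasure ?\<nu> {..<R}"
  proof (cases "R > 0")
    case True
    then show ?thesis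
      using nn_integral_power_lessThan[OF True D]
      by (simp add: \<nu>_lessThan nn_integral_ball_scale[OF h scale_inv True] mult.commute mult.assoc)
  next
    case False
    then have "(\<integral>\<^sup>+r. ?\<rho> r * indicator {..<R} r \<partial>lborel) = (\<integral>\<^sup>+(r::real). 0 \<partial>lborel)"
      by (intro nn_integral_cong) (auto simp: indicator_def)
    then show ?thesis using False by (simp add: \<nu>_lessThan ball_empty)
  qed
  finally show "emeasure ?\<nu> {..<R} = emeasure (density lborel (\<lambda>r. ?I * ?\<rho> r)) {..<R}" ..
qed

lemma nn_integral_polar:
  fixes h :: "'a::euclidean_space \<Rightarrow> ennreal" and W :: "real \<Rightarrow> ennreal"
  assumes h[measurable]: "h \<in> borel_measurable borel"
    and scale_inv: "\<And>c x. c > 0 \<Longrightarrow> h (c *\<^sub>R x) = h x"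
    and bounded: "\<And>x. h x \<le> ennreal B"
    and W[measurable]: "W \<in> borel_measurable borel"
  shows "(\<integral>\<^sup>+x. h x * W (norm x) \<partial>lborel) =
     (\<integral>\<^sup>+x. h x * indicator (ball 0 1) x \<partial>lborel) *
     (\<integral>\<^sup>+r. ennreal (real DIM('a) * r ^ (DIM('a) - 1)) * indicator {0..} r * W r \<partial>lborel)"
proof -
  define I where "I = (\<integral>\<^sup>+x. h x * indicator (ball 0 1) x \<partial>lborel)"
  define \<rho> where "\<rho> r = ennreal (real DIM('a) * r ^ (DIM('a) - 1)) * indicator {0..} r" for r :: real
  have [measurable]: "\<rho> \<in> borel_measurable borel" unfolding \<rho>_def by measurable
  have "(\<integral>\<^sup>+x. h x * W (norm x) \<partial>lborel) = (\<integral>\<^sup>+r. W r \<partial>distr (density lborel h) borel norm)"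
    by (simp add: nn_integral_distr nn_integral_density)
  also have "\<dots> = (\<integral>\<^sup>+r. W r \<partial>density lborel (\<lambda>r. I * \<rho> r))"
    unfolding I_def \<rho>_def by (subst distr_norm_density_scale_invariant[OF h scale_inv bounded]) simp_all
  also have "\<dots> = (\<integral>\<^sup>+r. I * (\<rho> r * W r) \<partial>lborel)"
    by (subst nn_integral_density) (simp_all add: mult.assoc)
  also have "\<dots> = I * (\<integral>\<^sup>+r. \<rho> r * W r \<partial>lborel)"
    by (rule nn_integral_cmult) measurable
  finally show ?thesis unfolding I_def \<rho>_def .
qed

section \<open>Gaussian integrals\<close>

lemma nn_integral_exp_quadratic:
  "(\<integral>\<^sup>+y. ennreal (exp (c * y - y\<^sup>2)) \<partial>lborel) = ennreal (sqrt pi * exp (c\<^sup>2 / 4))"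
proof -
  have "exp (c * y - y\<^sup>2) = sqrt pi * exp (c\<^sup>2 / 4) * normal_density (c / 2) (1 / sqrt 2) y" for y
  proof -
    have "exp (c * y - y\<^sup>2) = exp (c\<^sup>2 / 4) * exp (- (y - c / 2)\<^sup>2)"
      by (simp add: exp_add[symmetric] power2_eq_square algebra_simps)
    then show ?thesis by (simp add: normal_density_def power_divide)
  qed
  then have "(\<integral>\<^sup>+y. ennreal (exp (c * y - y\<^sup>2)) \<partial>lborel)
      = (\<integral>\<^sup>+y. ennreal (sqrt pi * exp (c\<^sup>2 / 4)) * ennreal (normal_density (c / 2) (1 / sqrt 2) y) \<partial>lborel)"
    by (intro nn_integral_cong) (simp add: ennreal_mult')
  also have "\<dots> = ennreal (sqrt pi * exp (c\<^sup>2 / 4)) * (\<integral>\<^sup>+y. ennreal (normal_density (c / 2) (1 / sqrt 2) y) \<partial>lborel)"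
    by (rule nn_integral_cmult) measurable
  also have "(\<integral>\<^sup>+y. ennreal (normal_density (c / 2) (1 / sqrt 2) y) \<partial>lborel) = 1"
    by (subst nn_integral_eq_integral) auto
  finally show ?thesis by simp
qed

lemma nn_integral_exp_inner_gaussian:
  fixes a :: "'a::euclidean_space"
  shows "(\<integral>\<^sup>+x. ennreal (exp (s * (x \<bullet> a) - (norm x)\<^sup>2)) \<partial>lborel)
       = ennreal (sqrt pi ^ DIM('a) * exp (s\<^sup>2 * (norm a)\<^sup>2 / 4))"
proof -
  interpret product_sigma_finite "\<lambda>_::'a. lborel :: real measure"
    by (simp add: product_sigma_finite_def sigma_finite_lborel)
  have coords: "exp (s * ((\<Sum>b\<in>Basis. f b *\<^sub>R b) \<bullet> a) - (norm (\<Sum>b\<in>Basis. f b *\<^sub>R b))\<^sup>2)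
      = (\<Prod>b\<in>Basis. exp (s * (b \<bullet> a) * f b - (f b)\<^sup>2))" for f :: "'a \<Rightarrow> real"
  proof -
    define y where "y = (\<Sum>b\<in>Basis. f b *\<^sub>R b)"
    have y: "y \<bullet> b = f b" if "b \<in> Basis" for b
      using that unfolding y_def by (simp add: inner_sum_left inner_Basis if_distrib cong: if_cong)
    then have y': "b \<bullet> y = f b" if "b \<in> Basis" for b
      using that by (simp add: inner_commute)
    have "s * (y \<bullet> a) - (norm y)\<^sup>2 = (\<Sum>b\<in>Basis. s * (b \<bullet> a) * f b - (f b)\<^sup>2)"
      unfolding power2_norm_eq_inner euclidean_inner[of y a] euclidean_inner[of y y]
      by (simp add: y y' sum_subtractf sum_distrib_left power2_eq_square inner_commute[of a] algebra_simps)
    then show ?thesis unfolding y_def[symmetric] by (simp add: exp_sum)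
  qed
  have "(\<integral>\<^sup>+x. ennreal (exp (s * (x \<bullet> a) - (norm x)\<^sup>2)) \<partial>lborel)
      = (\<integral>\<^sup>+f. (\<Prod>b\<in>Basis. ennreal (exp (s * (b \<bullet> a) * f b - (f b)\<^sup>2))) \<partial>(\<Pi>\<^sub>M b\<in>Basis. lborel))"
    by (subst lborel_eq) (simp add: nn_integral_distr coords prod_ennreal)
  also have "\<dots> = (\<Prod>b\<in>Basis. (\<integral>\<^sup>+y. ennreal (exp (s * (b \<bullet> a) * y - y\<^sup>2)) \<partial>lborel))"
    by (rule product_nn_integral_prod) auto
  also have "\<dots> = ennreal (\<Prod>b\<in>Basis. sqrt pi * exp ((s * (b \<bullet> a))\<^sup>2 / 4))"
    by (simp add: nn_integral_exp_quadratic prod_ennreal)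
  also have "(\<Prod>b\<in>Basis. sqrt pi * exp ((s * (b \<bullet> a))\<^sup>2 / 4)) = sqrt pi ^ DIM('a) * exp (s\<^sup>2 * (norm a)\<^sup>2 / 4)"
  proof -
    have "(\<Sum>b\<in>Basis. (s * (b \<bullet> a))\<^sup>2 / 4) = s\<^sup>2 * (\<Sum>b\<in>Basis. (b \<bullet> a)\<^sup>2) / 4"
      by (simp add: power_mult_distrib sum_distrib_left sum_divide_distrib)
    also have "(\<Sum>b\<in>Basis. (b \<bullet> a)\<^sup>2) = (norm a)\<^sup>2"
      unfolding power2_norm_eq_inner euclidean_inner[of a a] by (simp add: power2_eq_square inner_commute)
    finally show ?thesis by (simp add: prod.distrib exp_sum[symmetric])
  qed
  finally show ?thesis .
qed

lemma nn_integral_cosh_inner_gaussian: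
  fixes a :: "'a::euclidean_space"
  shows "(\<integral>\<^sup>+x. ennreal (cosh (s * (x \<bullet> a)) * exp (- (norm x)\<^sup>2)) \<partial>lborel)
       = ennreal (sqrt pi ^ DIM('a) * exp (s\<^sup>2 * (norm a)\<^sup>2 / 4))"
proof -
  define V where "V = sqrt pi ^ DIM('a) * exp (s\<^sup>2 * (norm a)\<^sup>2 / 4)"
  have half: "(\<integral>\<^sup>+x. ennreal (exp (t * (x \<bullet> a) - (norm x)\<^sup>2) / 2) \<partial>lborel) = ennreal (V / 2)"
    if "t\<^sup>2 = s\<^sup>2" for t
  proof -
    have "(\<integral>\<^sup>+x. ennreal (exp (t * (x \<bullet> a) - (norm x)\<^sup>2) / 2) \<partial>lborel)
        = (\<integral>\<^sup>+x. ennreal (1 / 2) * ennreal (exp (t * (x \<bullet> a) - (norm x)\<^sup>2)) \<partial>lborel)"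
      by (intro nn_integral_cong, subst ennreal_mult[symmetric]) auto
    also have "\<dots> = ennreal (1 / 2) * ennreal V"
      using that by (simp add: nn_integral_cmult nn_integral_exp_inner_gaussian V_def)
    also have "\<dots> = ennreal (V / 2)"
      by (subst ennreal_mult[symmetric]) (auto simp: V_def)
    finally show ?thesis .
  qed
  have "ennreal (cosh (s * (x \<bullet> a)) * exp (- (norm x)\<^sup>2))
      = ennreal (exp (s * (x \<bullet> a) - (norm x)\<^sup>2) / 2) + ennreal (exp ((- s) * (x \<bullet> a) - (norm x)\<^sup>2) / 2)"
    for x :: 'a
    by (simp add: cosh_def exp_diff exp_minus field_simps ennreal_plus[symmetric] del: ennreal_plus)
  then have "(\<integral>\<^sup>+x. ennreal (cosh (s * (x \<bullet> a)) * exp (- (norm x)\<^sup>2)) \<partial>lborel)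
      = ennreal (V / 2) + ennreal (V / 2)"
    using half[of s] half[of "- s"] by (simp add: nn_integral_add)
  also have "\<dots> = ennreal V"
    by (simp add: V_def ennreal_plus[symmetric] del: ennreal_plus)
  finally show ?thesis unfolding V_def .
qed

text \<open>The closed forms of \<open>\<integral>\<^sub>0\<^sup>\<infinity> r\<^sup>p exp (- r\<^sup>2) dr\<close> given by \<open>gaussian_moment_even_pos\<close> and
  \<open>gaussian_moment_odd_pos\<close>.\<close>
definition half_gaussian_moment :: "nat \<Rightarrow> real" where
  "half_gaussian_moment p =
     (if even p then sqrt pi / 2 * (fact p / (2 ^ p * fact (p div 2))) else fact (p div 2) / 2)"

lemma has_bochner_integral_half_gaussian_moment:
  "has_bochner_integral lborel (\<lambda>x::real. indicator {0..} x *\<^sub>R (exp (- x\<^sup>2) * x ^ p))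
     (half_gaussian_moment p)"
proof (cases "even p")
  case True
  then obtain i where "p = 2 * i" by (auto elim: evenE)
  then show ?thesis using gaussian_moment_even_pos[of i] by (simp add: half_gaussian_moment_def)
next
  case False
  then obtain i where "p = 2 * i + 1" by (auto elim: oddE)
  then show ?thesis using gaussian_moment_odd_pos[of i] by (simp add: half_gaussian_moment_def)
qed

lemma half_gaussian_moment_pos: "half_gaussian_moment p > 0"
  by (simp add: half_gaussian_moment_def)

lemma nn_integral_half_gaussian_moment:
  "(\<integral>\<^sup>+r. indicator {0..} r * ennreal (r ^ p * exp (- r\<^sup>2)) \<partial>lborel) = ennreal (half_gaussian_moment p)"
proof -
  have "(\<integral>\<^sup>+r. indicator {0..} r * ennreal (r ^ p * exp (- r\<^sup>2)) \<partial>lborel)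
      = (\<integral>\<^sup>+r. ennreal (indicator {0..} r *\<^sub>R (exp (- r\<^sup>2) * r ^ p)) \<partial>lborel)"
    by (intro nn_integral_cong) (auto simp: indicator_def mult.commute)
  also have "\<dots> = ennreal (half_gaussian_moment p)"
    using has_bochner_integral_half_gaussian_moment[of p]
    by (subst nn_integral_eq_integral) (auto simp: has_bochner_integral_iff indicator_def)
  finally show ?thesis .
qed

lemma half_gaussian_moment_add_2:
  "half_gaussian_moment (p + 2) = (real p + 1) / 2 * half_gaussian_moment p"
proof (cases "even p")
  case True
  then obtain i where p: "p = 2 * i" by (auto elim: evenE)
  have "fact (2 * Suc i) = (real i + 1) * (2 * (2 * real i + 1) * fact (2 * i))"
    by (simp add: fact_Suc algebra_simps)
  moreover have "2 ^ (2 * Suc i) * fact (Suc i) = (real i + 1) * (4 * 2 ^ (2 * i) * fact i)"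
    by (simp add: fact_Suc algebra_simps)
  ultimately have "fact (2 * Suc i) / (2 ^ (2 * Suc i) * fact (Suc i))
      = 2 * (2 * real i + 1) * fact (2 * i) / (4 * 2 ^ (2 * i) * fact i)"
    by (simp only: mult_divide_mult_cancel_left_if) simp
  also have "\<dots> = (2 * real i + 1) / 2 * (fact (2 * i) / (2 ^ (2 * i) * fact i))"
    by (simp add: field_simps)
  finally have "fact (2 * Suc i) / (2 ^ (2 * Suc i) * fact (Suc i))
      = (2 * real i + 1) / 2 * (fact (2 * i) / (2 ^ (2 * i) * fact i) :: real)" .
  then show ?thesis
    using p by (simp add: half_gaussian_moment_def)
next
  case False
  then obtain i where "p = 2 * i + 1" by (auto elim: oddE)
  then show ?thesis
    by (simp add: half_gaussian_moment_def field_simps)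
qed

lemma half_gaussian_moment_add_pochhammer:
  "half_gaussian_moment (p + 2 * j) = half_gaussian_moment p * pochhammer ((real p + 1) / 2) j"
proof (induction j)
  case (Suc j)
  have "half_gaussian_moment (p + 2 * Suc j) = (real (p + 2 * j) + 1) / 2 * half_gaussian_moment (p + 2 * j)"
    using half_gaussian_moment_add_2[of "p + 2 * j"] by (simp add: algebra_simps)
  then show ?case
    unfolding Suc pochhammer_Suc by (simp add: field_simps)
qed simp

section \<open>Angular moments\<close>

lemma powser_zero_on_pos_imp_coeffs_zero:
  fixes c :: "nat \<Rightarrow> real"
  assumes summable: "\<And>z. summable (\<lambda>j. c j * z ^ j)" and zero: "\<And>z. z > 0 \<Longrightarrow> (\<Sum>j. c j * z ^ j) = 0"
  shows "c n = 0"
proof (induction n rule: less_induct)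
  case (less n)
  define g where "g z = (\<Sum>j. c (j + n) * z ^ j)" for z
  have summable_g: "summable (\<lambda>j. c (j + n) * z ^ j)" for z
  proof (cases "z = 0")
    case False
    have "summable (\<lambda>j. c (j + n) * z ^ (j + n) * inverse (z ^ n))"
      using summable_ignore_initial_segment[OF summable[of z], of n] by (intro summable_mult2) simp
    then show ?thesis using False by (simp add: power_add field_simps)
  qed simp
  have "g z = 0" if z: "z > 0" for z
  proof -
    have "(\<lambda>j. c (j + n) * z ^ (j + n)) sums ((\<Sum>j. c j * z ^ j) - (\<Sum>i<n. c i * z ^ i))"
      using sums_split_initial_segment[OF summable_sums[OF summable]] by simp
    then have "(\<lambda>j. c (j + n) * z ^ (j + n)) sums 0"
      using zero[OF z] less by simp
    moreover have "(\<lambda>j. c (j + n) * z ^ (j + n)) sums (z ^ n * g z)"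
      unfolding g_def using sums_mult[OF summable_sums[OF summable_g], of "z ^ n"]
      by (simp add: power_add algebra_simps)
    ultimately show ?thesis using z sums_unique2 by fastforce
  qed
  then have "(g \<longlongrightarrow> 0) (at_right 0)"
    by (intro tendsto_eventually eventually_mono[OF eventually_at_right_less[of 0]]) auto
  moreover have "isCont g 0"
    unfolding g_def by (rule isCont_powser_converges_everywhere) (rule summable_g)
  then have "(g \<longlongrightarrow> g 0) (at_right 0)"
    by (simp add: isCont_def filterlim_at_split)
  ultimately have "g 0 = 0"
    using tendsto_unique[OF trivial_limit_at_right_real] by blast
  then show ?case unfolding g_def using powser_zero[of "\<lambda>j. c (j + n)"] by simp
qed

lemma powser_coeffs_unique:
  fixes c d :: "nat \<Rightarrow> real"
  assumes "\<And>z. summable (\<lambda>j. c j * z ^ j)" and "\<And>z. summable (\<lambda>j. d j * z ^ j)"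
    and "\<And>z. z > 0 \<Longrightarrow> (\<Sum>j. c j * z ^ j) = (\<Sum>j. d j * z ^ j)"
  shows "c = d"
proof -
  have "c n - d n = 0" for n
  proof (rule powser_zero_on_pos_imp_coeffs_zero)
    show "summable (\<lambda>j. (c j - d j) * z ^ j)" for z
      using summable_diff[OF assms(1)[of z] assms(2)[of z]] by (simp add: algebra_simps)
    show "(\<Sum>j. (c j - d j) * z ^ j) = 0" if "z > 0" for z
      using suminf_diff[OF assms(1)[of z] assms(2)[of z]] assms(3)[OF that] by (simp add: algebra_simps)
  qed
  then show ?thesis by auto
qed

lemma sums_cosh: "(\<lambda>j. y ^ (2 * j) / fact (2 * j)) sums cosh (y :: real)"
proof -
  have "(\<lambda>j. \<Sum>i\<in>{j * 2..<j * 2 + 2}. if even i then y ^ i /\<^sub>R fact i else 0) sums cosh y"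
    by (rule sums_group[OF cosh_converges]) simp
  moreover have "{j * 2..<j * 2 + 2} = {2 * j, Suc (2 * j)}" for j by auto
  ultimately show ?thesis by (simp add: divide_inverse mult.commute)
qed

lemma borel_measurable_cosh [measurable (raw)]:
  assumes "f \<in> borel_measurable M"
  shows "(\<lambda>x. cosh (f x :: real)) \<in> borel_measurable M"
proof -
  have "(cosh :: real \<Rightarrow> real) \<in> borel_measurable borel"
    by (intro borel_measurable_continuous_onI continuous_intros)
  from measurable_compose[OF assms this] show ?thesis .
qed

lemma nn_integral_cosh_expansion:
  fixes f :: "'a \<Rightarrow> real" and g :: "'a \<Rightarrow> ennreal"
  assumes [measurable]: "f \<in> borel_measurable M" "g \<in> borel_measurable M"
  shows "(\<integral>\<^sup>+x. ennreal (cosh (s * f x)) * g x \<partial>M)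
       = (\<Sum>j. ennreal (s ^ (2 * j) / fact (2 * j)) * (\<integral>\<^sup>+x. ennreal (f x ^ (2 * j)) * g x \<partial>M))"
proof -
  have "ennreal (cosh (s * f x)) * g x
      = (\<Sum>j. ennreal (s ^ (2 * j) / fact (2 * j)) * (ennreal (f x ^ (2 * j)) * g x))" for x
  proof -
    have "ennreal (cosh (s * f x)) = (\<Sum>j. ennreal (s ^ (2 * j) / fact (2 * j)) * ennreal (f x ^ (2 * j)))"
      using sums_cosh[of "s * f x"]
      by (subst suminf_ennreal_eq[symmetric])
         (auto simp: power_mult ennreal_mult[symmetric] power_mult_distrib mult_ac)
    then show ?thesis
      by (simp only: mult.assoc[symmetric] ennreal_suminf_multc)
  qed
  then have "(\<integral>\<^sup>+x. ennreal (cosh (s * f x)) * g x \<partial>M)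
      = (\<Sum>j. \<integral>\<^sup>+x. ennreal (s ^ (2 * j) / fact (2 * j)) * (ennreal (f x ^ (2 * j)) * g x) \<partial>M)"
    by (simp add: nn_integral_suminf)
  also have "\<dots> = (\<Sum>j. ennreal (s ^ (2 * j) / fact (2 * j)) * (\<integral>\<^sup>+x. ennreal (f x ^ (2 * j)) * g x \<partial>M))"
    by (intro suminf_cong nn_integral_cmult) measurable
  finally show ?thesis .
qed

lemma abs_inner_sgn_power_le_1:
  fixes a x :: "'a::real_inner"
  assumes "norm a = 1"
  shows "\<bar>((x /\<^sub>R norm x) \<bullet> a) ^ n\<bar> \<le> 1"
proof -
  have "\<bar>(x /\<^sub>R norm x) \<bullet> a\<bar> \<le> norm (x /\<^sub>R norm x) * norm a" by (rule Cauchy_Schwarz_ineq2)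
  also have "\<dots> \<le> 1" using assms by (cases "x = 0") auto
  finally show ?thesis by (simp add: power_abs power_le_one)
qed

lemma nn_integral_inner_power_gaussian_polar:
  fixes a :: "'a::euclidean_space"
  assumes "norm a = 1"
  shows "(\<integral>\<^sup>+x. ennreal ((x \<bullet> a) ^ (2 * j) * exp (- (norm x)\<^sup>2)) \<partial>lborel)
       = (\<integral>\<^sup>+x. ennreal (((x /\<^sub>R norm x) \<bullet> a) ^ (2 * j)) * indicator (ball 0 1) x \<partial>lborel)
         * ennreal (real DIM('a) * half_gaussian_moment (DIM('a) - 1 + 2 * j))"
proof -
  have "((x /\<^sub>R norm x) \<bullet> a) * norm x = x \<bullet> a" for x :: 'a
    by (cases "x = 0") auto
  then have "(x \<bullet> a) ^ (2 * j) = ((x /\<^sub>R norm x) \<bullet> a) ^ (2 * j) * norm x ^ (2 * j)" for x :: 'a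
    by (metis power_mult_distrib)
  then have "(\<integral>\<^sup>+x. ennreal ((x \<bullet> a) ^ (2 * j) * exp (- (norm x)\<^sup>2)) \<partial>lborel)
      = (\<integral>\<^sup>+x. ennreal (((x /\<^sub>R norm x) \<bullet> a) ^ (2 * j)) * ennreal (norm x ^ (2 * j) * exp (- (norm x)\<^sup>2)) \<partial>lborel)"
    by (intro nn_integral_cong) (simp add: ennreal_mult[symmetric] mult.assoc power_mult)
  also have "\<dots> = (\<integral>\<^sup>+x. ennreal (((x /\<^sub>R norm x) \<bullet> a) ^ (2 * j)) * indicator (ball 0 1) x \<partial>lborel)
      * (\<integral>\<^sup>+r. ennreal (real DIM('a) * r ^ (DIM('a) - 1)) * indicator {0..} r * ennreal (r ^ (2 * j) * exp (- r\<^sup>2)) \<partial>lborel)"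
  proof (rule nn_integral_polar[where B = 1])
    fix c :: real and x :: 'a assume "c > 0"
    then have "c *\<^sub>R x /\<^sub>R norm (c *\<^sub>R x) = x /\<^sub>R norm x"
      by (metis sgn_div_norm sgn_scaleR sgn_pos scaleR_one)
    then show "ennreal (((c *\<^sub>R x /\<^sub>R norm (c *\<^sub>R x)) \<bullet> a) ^ (2 * j)) = ennreal (((x /\<^sub>R norm x) \<bullet> a) ^ (2 * j))"
      by (simp only:)
  next
    fix x :: 'a
    have "\<bar>((x /\<^sub>R norm x) \<bullet> a) ^ (2 * j)\<bar> \<le> 1"
      by (rule abs_inner_sgn_power_le_1[OF assms])
    then show "ennreal (((x /\<^sub>R norm x) \<bullet> a) ^ (2 * j)) \<le> ennreal 1"
      by (intro ennreal_leI) simp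
  qed measurable
  also have "(\<integral>\<^sup>+r. ennreal (real DIM('a) * r ^ (DIM('a) - 1)) * indicator {0..} r * ennreal (r ^ (2 * j) * exp (- r\<^sup>2)) \<partial>lborel)
      = (\<integral>\<^sup>+r. ennreal (real DIM('a)) * (indicator {0..} r * ennreal (r ^ (DIM('a) - 1 + 2 * j) * exp (- r\<^sup>2))) \<partial>lborel)"
    by (intro nn_integral_cong, subst power_add)
       (auto simp: indicator_def ennreal_mult[symmetric] mult_ac)
  also have "\<dots> = ennreal (real DIM('a) * half_gaussian_moment (DIM('a) - 1 + 2 * j))"
    using half_gaussian_moment_pos[of "DIM('a) - 1 + 2 * j"]
    by (simp add: nn_integral_cmult nn_integral_half_gaussian_moment ennreal_mult)
  finally show ?thesis .
qed

lemma suminf_inner_power_gaussian: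
  fixes a :: "'a::euclidean_space"
  shows "(\<Sum>j. ennreal (s ^ (2 * j) / fact (2 * j)) * (\<integral>\<^sup>+x. ennreal ((x \<bullet> a) ^ (2 * j) * exp (- (norm x)\<^sup>2)) \<partial>lborel))
       = ennreal (sqrt pi ^ DIM('a) * exp (s\<^sup>2 * (norm a)\<^sup>2 / 4))"
  using nn_integral_cosh_expansion[of "\<lambda>x. x \<bullet> a" lborel "\<lambda>x. ennreal (exp (- (norm x)\<^sup>2))" s]
  by (simp add: ennreal_mult[symmetric] nn_integral_cosh_inner_gaussian)

lemma nn_integral_ball_inner_sgn_power_le:
  fixes a :: "'a::euclidean_space"
  assumes "norm a = 1"
  shows "(\<integral>\<^sup>+x. ennreal (((x /\<^sub>R norm x) \<bullet> a) ^ n) * indicator (ball 0 1) x \<partial>lborel)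
       \<le> ennreal (measure lborel (ball (0::'a) 1))"
proof -
  have "(\<integral>\<^sup>+x. ennreal (((x /\<^sub>R norm x) \<bullet> a) ^ n) * indicator (ball 0 1) x \<partial>lborel)
      \<le> (\<integral>\<^sup>+x. 1 * indicator (ball (0::'a) 1) x \<partial>lborel)"
    using abs_inner_sgn_power_le_1[OF assms] by (intro nn_integral_mono) (auto simp: indicator_def abs_le_iff)
  also have "\<dots> = ennreal (measure lborel (ball (0::'a) 1))"
    using emeasure_lborel_ball_finite[of "0::'a" 1] by (simp add: emeasure_eq_ennreal_measure)
  finally show ?thesis .
qed

lemma sums_ball_inner_sgn_power:
  fixes a :: "'a::euclidean_space"
  assumes a: "norm a = 1"
  defines "m \<equiv> \<lambda>j. enn2real (\<integral>\<^sup>+x. ennreal (((x /\<^sub>R norm x) \<bullet> a) ^ (2 * j)) * indicator (ball 0 1) x \<partial>lborel)"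
  shows "(\<lambda>j. m j * (real DIM('a) * half_gaussian_moment (DIM('a) - 1 + 2 * j) / fact (2 * j)) * (s\<^sup>2) ^ j)
           sums (sqrt pi ^ DIM('a) * exp (s\<^sup>2 / 4))"
proof -
  define p where "p j = m j * (real DIM('a) * half_gaussian_moment (DIM('a) - 1 + 2 * j) / fact (2 * j))" for j
  have M: "(\<integral>\<^sup>+x. ennreal (((x /\<^sub>R norm x) \<bullet> a) ^ (2 * j)) * indicator (ball 0 1) x \<partial>lborel) = ennreal (m j)" for j
    using le_less_trans[OF nn_integral_ball_inner_sgn_power_le[OF a, of "2 * j"] ennreal_less_top]
    by (simp add: m_def)
  have p_nonneg: "0 \<le> p j * (s\<^sup>2) ^ j" for j
    using half_gaussian_moment_pos[of "DIM('a) - 1 + 2 * j"] by (simp add: p_def m_def)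
  have "ennreal (s ^ (2 * j) / fact (2 * j))
          * (\<integral>\<^sup>+x. ennreal ((x \<bullet> a) ^ (2 * j) * exp (- (norm x)\<^sup>2)) \<partial>lborel)
        = ennreal (p j * (s\<^sup>2) ^ j)" for j
  proof -
    have "0 \<le> m j" "0 \<le> half_gaussian_moment (DIM('a) - 1 + 2 * j)"
      using half_gaussian_moment_pos[of "DIM('a) - 1 + 2 * j"] by (simp_all add: m_def)
    moreover have "(s ^ j)\<^sup>2 = (s\<^sup>2) ^ j"
      by (metis power_even_eq power_mult)
    ultimately show ?thesis
      unfolding nn_integral_inner_power_gaussian_polar[OF a] M
      by (simp add: p_def ennreal_mult[symmetric] power_mult mult_ac)
  qed
  then have "(\<Sum>j. ennreal (p j * (s\<^sup>2) ^ j)) = ennreal (sqrt pi ^ DIM('a) * exp (s\<^sup>2 / 4))"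
    using suminf_inner_power_gaussian[of s a] a by simp
  then have "(\<lambda>j. ennreal (p j * (s\<^sup>2) ^ j)) sums ennreal (sqrt pi ^ DIM('a) * exp (s\<^sup>2 / 4))"
    by (metis summable_sums summableI)
  then show ?thesis
    using p_nonneg unfolding p_def by (subst (asm) sums_ennreal) auto
qed

lemma ball_inner_sgn_power_coeff:
  fixes a :: "'a::euclidean_space"
  assumes a: "norm a = 1"
  defines "m \<equiv> \<lambda>j. enn2real (\<integral>\<^sup>+x. ennreal (((x /\<^sub>R norm x) \<bullet> a) ^ (2 * j)) * indicator (ball 0 1) x \<partial>lborel)"
  shows "m j * (real DIM('a) * half_gaussian_moment (DIM('a) - 1 + 2 * j) / fact (2 * j))
       = sqrt pi ^ DIM('a) / (4 ^ j * fact j)"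
proof -
  define p where "p j = m j * (real DIM('a) * half_gaussian_moment (DIM('a) - 1 + 2 * j) / fact (2 * j))" for j
  define q where "q j = sqrt pi ^ DIM('a) / (4 ^ j * fact j)" for j
  have p_sums: "(\<lambda>j. p j * (s\<^sup>2) ^ j) sums (sqrt pi ^ DIM('a) * exp (s\<^sup>2 / 4))" for s
    unfolding p_def m_def using sums_ball_inner_sgn_power[OF a] by simp
  have q_sums: "(\<lambda>j. q j * z ^ j) sums (sqrt pi ^ DIM('a) * exp (z / 4))" for z
  proof -
    have "q j * z ^ j = sqrt pi ^ DIM('a) * ((z / 4) ^ j /\<^sub>R fact j)" for j
      by (simp add: q_def power_divide field_simps)
    then show ?thesis
      using sums_mult[OF exp_converges[of "z / 4"], of "sqrt pi ^ DIM('a)"] by simp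
  qed
  have "p = q"
  proof (rule powser_coeffs_unique)
    fix z :: real
    show "summable (\<lambda>j. q j * z ^ j)" using q_sums by (rule sums_summable)
    have "p j \<ge> 0" for j
      using half_gaussian_moment_pos[of "DIM('a) - 1 + 2 * j"] by (simp add: p_def m_def)
    moreover have "summable (\<lambda>j. p j * \<bar>z\<bar> ^ j)"
      using p_sums[of "sqrt \<bar>z\<bar>"] by (simp add: sums_summable)
    ultimately have "summable (\<lambda>j. norm (p j * z ^ j))"
      by (simp add: abs_mult power_abs)
    then show "summable (\<lambda>j. p j * z ^ j)"
      by (rule summable_norm_cancel)
  next
    fix z :: real assume "z > 0"
    then show "(\<Sum>j. p j * z ^ j) = (\<Sum>j. q j * z ^ j)"
      using p_sums[of "sqrt z"] q_sums[of z] by (simp add: sums_iff)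
  qed
  then show ?thesis by (simp add: p_def q_def fun_eq_iff)
qed

text \<open>The even moments of the angular part of \<open>x\<close> are found by expanding
  \<open>\<integral> cosh (s x \<bullet> a) exp (- \<parallel>x\<parallel>\<^sup>2) dx = \<pi>\<^sup>D\<^sup>/\<^sup>2 exp (s\<^sup>2 / 4)\<close> in powers of \<open>s\<close> on both sides, integrating the
  left-hand side in polar coordinates, and comparing coefficients.\<close>
lemma nn_integral_ball_inner_sgn_power:
  fixes a :: "'a::euclidean_space"
  assumes a: "norm a = 1"
  shows "(\<integral>\<^sup>+x. ennreal (((x /\<^sub>R norm x) \<bullet> a) ^ (2 * j)) * indicator (ball 0 1) x \<partial>lborel)
       = ennreal (measure lborel (ball (0::'a) 1) * fact (2 * j) * mgf_coeff (real DIM('a)) j)"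
proof -
  define D where "D = DIM('a)"
  have D: "D \<ge> 1" by (simp add: D_def DIM_positive Suc_leI)
  define V where "V = measure lborel (ball (0::'a) 1)"
  define m where "m j = enn2real (\<integral>\<^sup>+x. ennreal (((x /\<^sub>R norm x) \<bullet> a) ^ (2 * j)) * indicator (ball 0 1) x \<partial>lborel)"
    for j
  have M: "(\<integral>\<^sup>+x. ennreal (((x /\<^sub>R norm x) \<bullet> a) ^ (2 * j)) * indicator (ball 0 1) x \<partial>lborel) = ennreal (m j)"
    using le_less_trans[OF nn_integral_ball_inner_sgn_power_le[OF a, of "2 * j"] ennreal_less_top]
    by (simp add: m_def)
  have "m 0 = V"
    using emeasure_lborel_ball_finite[of "0::'a" 1] by (simp add: m_def V_def emeasure_eq_ennreal_measure)
  then have h0: "V * (real D * half_gaussian_moment (D - 1)) = sqrt pi ^ D"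
    using ball_inner_sgn_power_coeff[OF a, of 0] by (simp add: m_def D_def)
  have "m j * (real D * half_gaussian_moment (D - 1) * pochhammer (real D / 2) j)
      = fact (2 * j) * sqrt pi ^ D / (4 ^ j * fact j)"
    using ball_inner_sgn_power_coeff[OF a, of j] D half_gaussian_moment_add_pochhammer[of "D - 1" j]
    by (simp add: m_def D_def of_nat_diff field_simps)
  then have "m j = V * fact (2 * j) / (4 ^ j * fact j * pochhammer (real D / 2) j)"
    using half_gaussian_moment_pos[of "D - 1"] pochhammer_pos[of "real D / 2" j] D
    by (simp add: field_simps flip: h0)
  then show ?thesis
    unfolding M by (simp add: mgf_coeff_def V_def D_def)
qed

lemma nn_integral_ball_cosh_inner_sgn:
  fixes a :: "'a::euclidean_space"
  assumes a: "norm a = 1"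
  shows "(\<integral>\<^sup>+x. ennreal (cosh (t * ((x /\<^sub>R norm x) \<bullet> a))) * indicator (ball 0 1) x \<partial>lborel)
       = ennreal (measure lborel (ball (0::'a) 1) * sphere_mgf (real DIM('a)) (t\<^sup>2))"
proof -
  define V where "V = measure lborel (ball (0::'a) 1)"
  define k where "k = real DIM('a)"
  have k: "k \<ge> 1" by (simp add: k_def DIM_positive Suc_leI)
  have [measurable]: "ball (0::'a) 1 \<in> sets borel" by simp
  have "(\<integral>\<^sup>+x. ennreal (cosh (t * ((x /\<^sub>R norm x) \<bullet> a))) * indicator (ball 0 1) x \<partial>lborel)
      = (\<Sum>j. ennreal (t ^ (2 * j) / fact (2 * j))
               * (\<integral>\<^sup>+x. ennreal (((x /\<^sub>R norm x) \<bullet> a) ^ (2 * j)) * indicator (ball 0 1) x \<partial>lborel))"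
    by (rule nn_integral_cosh_expansion) measurable
  also have "\<dots> = (\<Sum>j. ennreal (V * mgf_coeff k j * (t\<^sup>2) ^ j))"
  proof (intro suminf_cong)
    fix j
    have "0 < mgf_coeff k j" using mgf_coeff_pos[of k j] k by simp
    then show "ennreal (t ^ (2 * j) / fact (2 * j))
        * (\<integral>\<^sup>+x. ennreal (((x /\<^sub>R norm x) \<bullet> a) ^ (2 * j)) * indicator (ball 0 1) x \<partial>lborel)
        = ennreal (V * mgf_coeff k j * (t\<^sup>2) ^ j)"
      by (subst nn_integral_ball_inner_sgn_power[OF a])
         (simp add: ennreal_mult[symmetric] V_def k_def power_mult)
  qed
  also have "\<dots> = ennreal (V * sphere_mgf k (t\<^sup>2))"
  proof (rule suminf_ennreal_eq)
    show "0 \<le> V * mgf_coeff k j * (t\<^sup>2) ^ j" for j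
      using mgf_coeff_pos[of k j] k by (simp add: V_def)
    show "(\<lambda>j. V * mgf_coeff k j * (t\<^sup>2) ^ j) sums (V * sphere_mgf k (t\<^sup>2))"
      unfolding sphere_mgf_def mult.assoc
      by (intro sums_mult summable_sums summable_mgf_coeff k)
  qed
  finally show ?thesis by (simp add: V_def k_def)
qed

lemma ennreal_exp_add_exp_minus: "ennreal (exp y) + ennreal (exp (- y)) = 2 * ennreal (cosh y)"
proof -
  have "ennreal (exp y) + ennreal (exp (- y)) = ennreal (2 * cosh y)"
    by (simp add: cosh_def ennreal_plus[symmetric] del: ennreal_plus)
  then show ?thesis by (simp add: ennreal_mult')
qed

text \<open>Only the even moments survive because the Lebesgue measure is invariant under \<open>x \<mapsto> -x\<close>.\<close>
lemma nn_integral_ball_exp_inner_sgn: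
  fixes a :: "'a::euclidean_space"
  assumes a: "norm a = 1"
  shows "(\<integral>\<^sup>+x. ennreal (exp (t * ((x /\<^sub>R norm x) \<bullet> a))) * indicator (ball 0 1) x \<partial>lborel)
       = ennreal (measure lborel (ball (0::'a) 1) * sphere_mgf (real DIM('a)) (t\<^sup>2))"
proof -
  define E where "E s = (\<integral>\<^sup>+x. ennreal (exp (s * ((x /\<^sub>R norm x) \<bullet> a))) * indicator (ball 0 1) x \<partial>lborel)"
    for s
  have "E t = E (- t)"
    unfolding E_def by (subst nn_integral_lborel_scaleR[of _ "-1"]) (auto simp: indicator_def)
  moreover have "E t + E (- t)
      = 2 * (\<integral>\<^sup>+x. ennreal (cosh (t * ((x /\<^sub>R norm x) \<bullet> a))) * indicator (ball 0 1) x \<partial>lborel)"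
  proof -
    have split: "ennreal (exp (t * ((x /\<^sub>R norm x) \<bullet> a))) * indicator (ball 0 1) x
        + ennreal (exp (- t * ((x /\<^sub>R norm x) \<bullet> a))) * indicator (ball 0 1) x
        = 2 * (ennreal (cosh (t * ((x /\<^sub>R norm x) \<bullet> a))) * indicator (ball 0 1) x)" for x :: 'a
      by (simp add: ennreal_exp_add_exp_minus distrib_right[symmetric] mult.assoc)
    have [measurable]: "ball (0::'a) 1 \<in> sets borel" "ball (0::'a) 1 \<in> sets lborel" by simp_all
    have "E t + E (- t) = (\<integral>\<^sup>+x. ennreal (exp (t * ((x /\<^sub>R norm x) \<bullet> a))) * indicator (ball 0 1) x
        + ennreal (exp (- t * ((x /\<^sub>R norm x) \<bullet> a))) * indicator (ball 0 1) x \<partial>lborel)"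
      unfolding E_def by (rule nn_integral_add[symmetric]) measurable
    also have "\<dots> = (\<integral>\<^sup>+x. 2 * (ennreal (cosh (t * ((x /\<^sub>R norm x) \<bullet> a))) * indicator (ball 0 1) x) \<partial>lborel)"
      by (simp only: split)
    also have "\<dots> = 2 * (\<integral>\<^sup>+x. ennreal (cosh (t * ((x /\<^sub>R norm x) \<bullet> a))) * indicator (ball 0 1) x \<partial>lborel)"
      by (rule nn_integral_cmult) measurable
    finally show ?thesis .
  qed
  ultimately have "2 * E t = 2 * (\<integral>\<^sup>+x. ennreal (cosh (t * ((x /\<^sub>R norm x) \<bullet> a))) * indicator (ball 0 1) x \<partial>lborel)"
    by (simp add: mult_2)
  then have "E t = (\<integral>\<^sup>+x. ennreal (cosh (t * ((x /\<^sub>R norm x) \<bullet> a))) * indicator (ball 0 1) x \<partial>lborel)"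
    by (simp add: ennreal_mult_cancel_left)
  then show ?thesis
    using nn_integral_ball_cosh_inner_sgn[OF a, of t] unfolding E_def by simp
qed

section \<open>The uniform distribution on the sphere\<close>

lemma prob_space_sphere_unif: "prob_space (sphere_unif TYPE('k::finite))"
proof -
  have "measure lborel (ball (0::real ^ 'k) 1) \<le> measure lborel (cball (0::real ^ 'k) 1)"
    using emeasure_lborel_cball_finite[of "0::real ^ 'k" 1]
    by (intro measure_mono_fmeasurable) (auto simp: fmeasurable_def)
  then have "measure lborel (cball (0::real ^ 'k) 1) > 0"
    using content_ball_pos[of 1 "0::real ^ 'k"] by simp
  then have "emeasure lborel (cball (0::real ^ 'k) 1) \<noteq> 0"
    by (auto simp: measure_def)
  then have "prob_space (uniform_measure lborel (cball (0::real ^ 'k) 1))"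
    using emeasure_lborel_cball_finite[of "0::real ^ 'k" 1] by (intro prob_space_uniform_measure) auto
  then show ?thesis
    unfolding sphere_unif_def by (rule prob_space.prob_space_distr) simp
qed

lemma sets_sphere_unif [simp, measurable_cong]: "sets (sphere_unif TYPE('k::finite)) = sets borel"
  by (simp add: sphere_unif_def)

lemma AE_sphere_unif_norm_le_1: "AE u in sphere_unif TYPE('k::finite). norm u \<le> 1"
proof -
  have "AE x in uniform_measure lborel (cball (0::real ^ 'k) 1). norm (x /\<^sub>R norm x) \<le> 1"
  proof (intro AE_I2)
    fix x :: "real ^ 'k"
    show "norm (x /\<^sub>R norm x) \<le> 1" by (cases "x = 0") auto
  qed
  then show ?thesis
    unfolding sphere_unif_def by (subst AE_distr_iff) auto
qed

lemma nn_integral_sphere_unif: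
  fixes g :: "real ^ 'k::finite \<Rightarrow> ennreal"
  assumes [measurable]: "g \<in> borel_measurable borel"
  shows "(\<integral>\<^sup>+u. g u \<partial>sphere_unif TYPE('k))
       = (\<integral>\<^sup>+x. g (x /\<^sub>R norm x) * indicator (ball 0 1) x \<partial>lborel) / ennreal (measure lborel (ball (0::real ^ 'k) 1))"
proof -
  have "sphere (0::real ^ 'k) 1 \<in> null_sets lborel"
    using negligible_sphere[of "0::real ^ 'k" 1]
    by (auto simp: null_sets_completion_iff negligible_iff_null_sets negligible_convex_frontier)
  then have ball_cball: "(\<integral>\<^sup>+x. f x * indicator (cball 0 1) x \<partial>lborel) = (\<integral>\<^sup>+x. f x * indicator (ball 0 1) x \<partial>lborel)"
    for f :: "real ^ 'k \<Rightarrow> ennreal"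
    by (intro nn_integral_cong_AE) (auto elim!: AE_mp[OF AE_not_in] simp: indicator_def)
  have "(\<integral>\<^sup>+u. g u \<partial>sphere_unif TYPE('k)) = (\<integral>\<^sup>+x. g (x /\<^sub>R norm x) \<partial>uniform_measure lborel (cball 0 1))"
    unfolding sphere_unif_def by (rule nn_integral_distr) auto
  also have "\<dots> = (\<integral>\<^sup>+x. g (x /\<^sub>R norm x) * indicator (ball 0 1) x \<partial>lborel) / emeasure lborel (cball (0::real ^ 'k) 1)"
    by (subst nn_integral_uniform_measure) (auto simp: ball_cball)
  also have "emeasure lborel (cball (0::real ^ 'k) 1) = ennreal (measure lborel (ball (0::real ^ 'k) 1))"
    using ball_cball[of "\<lambda>_. 1"] emeasure_lborel_ball_finite[of "0::real ^ 'k" 1]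
    by (simp add: emeasure_eq_ennreal_measure)
  finally show ?thesis .
qed

lemma nn_integral_sphere_unif_exp_inner:
  fixes w :: "real ^ 'k::finite"
  shows "(\<integral>\<^sup>+u. ennreal (exp (u \<bullet> w)) \<partial>sphere_unif TYPE('k)) = ennreal (sphere_mgf CARD('k) ((norm w)\<^sup>2))"
proof (cases "w = 0")
  case True
  interpret prob_space "sphere_unif TYPE('k)" by (rule prob_space_sphere_unif)
  show ?thesis using True by (simp add: emeasure_space_1)
next
  case False
  define a where "a = w /\<^sub>R norm w"
  have a: "norm a = 1" using False by (simp add: a_def)
  have w: "u \<bullet> w = norm w * (u \<bullet> a)" for u using False by (simp add: a_def)
  have V: "measure lborel (ball (0::real ^ 'k) 1) > 0" by (rule content_ball_pos) simp
  have "(\<integral>\<^sup>+u. ennreal (exp (u \<bullet> w)) \<partial>sphere_unif TYPE('k))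
      = (\<integral>\<^sup>+u. ennreal (exp (norm w * (u \<bullet> a))) \<partial>sphere_unif TYPE('k))"
    unfolding w ..
  also have "\<dots> = (\<integral>\<^sup>+x. ennreal (exp (norm w * ((x /\<^sub>R norm x) \<bullet> a))) * indicator (ball 0 1) x \<partial>lborel)
      / ennreal (measure lborel (ball (0::real ^ 'k) 1))"
    by (rule nn_integral_sphere_unif) measurable
  also have "\<dots> = ennreal (measure lborel (ball (0::real ^ 'k) 1) * sphere_mgf CARD('k) ((norm w)\<^sup>2))
      / ennreal (measure lborel (ball (0::real ^ 'k) 1))"
    by (subst nn_integral_ball_exp_inner_sgn[OF a]) simp
  also have "\<dots> = ennreal (sphere_mgf CARD('k) ((norm w)\<^sup>2))"
    using V sphere_mgf_ge_1[of "CARD('k)" "(norm w)\<^sup>2"] by (simp add: divide_ennreal)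
  finally show ?thesis .
qed

lemma nn_integral_sphere_unif_exp_inner_ge:
  fixes w :: "real ^ 'k::finite"
  assumes "\<bar>\<epsilon>\<bar> < 1"
  shows "ennreal ((1 - \<epsilon>\<^sup>2) powr (CARD('k) / 2) * exp (\<epsilon> * norm w))
       \<le> (\<integral>\<^sup>+u. ennreal (exp (u \<bullet> w)) \<partial>sphere_unif TYPE('k))"
proof -
  obtain n where "CARD('k) = Suc n" using not0_implies_Suc[of "CARD('k)"] by auto
  then show ?thesis
    using sphere_mgf_lower_bound[OF assms norm_ge_zero, of n w]
    by (simp add: nn_integral_sphere_unif_exp_inner ennreal_leI)
qed

section \<open>Lower bounds for \<open>Phi\<close>\<close>

lemma Phi_eq_nn_integral:
  fixes M :: "real ^ 'n ^ 'm"
  shows "Phi M = enn2real (\<integral>\<^sup>+u. (\<integral>\<^sup>+v. ennreal (exp (u \<bullet> (M *v v))) \<partial>sphere_unif TYPE('n)) \<partial>sphere_unif TYPE('m))"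
proof -
  interpret Sn: prob_space "sphere_unif TYPE('n)" by (rule prob_space_sphere_unif)
  have "continuous_on UNIV (\<lambda>p :: (real ^ 'm) \<times> (real ^ 'n). exp (fst p \<bullet> (M *v snd p)))"
    by (intro continuous_intros continuous_on_compose2[of UNIV "(*v) M" UNIV snd])
       (auto intro: continuous_intros)
  then have "(\<lambda>(u, v). exp (u \<bullet> (M *v v))) \<in> borel_measurable (borel \<Otimes>\<^sub>M borel :: ((real ^ 'm) \<times> (real ^ 'n)) measure)"
    unfolding borel_prod case_prod_beta' by (rule borel_measurable_continuous_onI)
  then have [measurable]: "(\<lambda>(u, v). exp (u \<bullet> (M *v v))) \<in> borel_measurable (sphere_unif TYPE('m) \<Otimes>\<^sub>M sphere_unif TYPE('n))"
    by (subst measurable_cong_sets[OF sets_pair_measure_cong refl]) simp_all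
  have "Phi M = enn2real (\<integral>\<^sup>+p. ennreal ((\<lambda>(u, v). exp (u \<bullet> (M *v v))) p) \<partial>(sphere_unif TYPE('m) \<Otimes>\<^sub>M sphere_unif TYPE('n)))"
    unfolding Phi_def by (rule integral_eq_nn_integral) (auto split: prod.splits)
  also have "(\<integral>\<^sup>+p. ennreal ((\<lambda>(u, v). exp (u \<bullet> (M *v v))) p) \<partial>(sphere_unif TYPE('m) \<Otimes>\<^sub>M sphere_unif TYPE('n)))
      = (\<integral>\<^sup>+u. (\<integral>\<^sup>+v. ennreal (exp (u \<bullet> (M *v v))) \<partial>sphere_unif TYPE('n)) \<partial>sphere_unif TYPE('m))"
    by (subst Sn.nn_integral_fst[symmetric]) (simp_all add: case_prod_beta')
  finally show ?thesis .
qed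

lemma nn_integral_sphere_unif_exp_bilinear_le:
  fixes M :: "real ^ 'n ^ 'm"
  shows "(\<integral>\<^sup>+u. (\<integral>\<^sup>+v. ennreal (exp (u \<bullet> (M *v v))) \<partial>sphere_unif TYPE('n)) \<partial>sphere_unif TYPE('m))
       \<le> ennreal (exp (onorm ((*v) M)))"
proof -
  interpret Sm: prob_space "sphere_unif TYPE('m)" by (rule prob_space_sphere_unif)
  interpret Sn: prob_space "sphere_unif TYPE('n)" by (rule prob_space_sphere_unif)
  define B where "B = onorm ((*v) M)"
  have bound: "exp (u \<bullet> (M *v v)) \<le> exp B" if "norm u \<le> 1" "norm v \<le> 1" for u v
  proof -
    have "u \<bullet> (M *v v) \<le> norm u * norm (M *v v)" by (rule Cauchy_Schwarz_ineq2[THEN abs_le_D1])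
    also have "\<dots> \<le> 1 * (B * norm v)"
      using that onorm[OF matrix_vector_mul_bounded_linear[of M], of v]
      by (intro mult_mono) (auto simp: B_def)
    also have "\<dots> \<le> B"
      using that onorm_pos_le[OF matrix_vector_mul_bounded_linear[of M]] by (simp add: B_def mult_left_le)
    finally show ?thesis by simp
  qed
  have inner: "(\<integral>\<^sup>+v. ennreal (exp (u \<bullet> (M *v v))) \<partial>sphere_unif TYPE('n)) \<le> ennreal (exp B)"
    if "norm u \<le> 1" for u :: "real ^ 'm"
  proof (rule Sn.nn_integral_le_const)
    show "AE v in sphere_unif TYPE('n). ennreal (exp (u \<bullet> (M *v v))) \<le> ennreal (exp B)"
      using AE_sphere_unif_norm_le_1 by eventually_elim (intro ennreal_leI bound that)
  qed simp
  have "AE u in sphere_unif TYPE('m).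
      (\<integral>\<^sup>+v. ennreal (exp (u \<bullet> (M *v v))) \<partial>sphere_unif TYPE('n)) \<le> ennreal (exp B)"
    using AE_sphere_unif_norm_le_1 by eventually_elim (rule inner)
  then show ?thesis
    unfolding B_def[symmetric] by (intro Sm.nn_integral_le_const) simp_all
qed

lemma nn_integral_sphere_unif_exp_bilinear_ge:
  fixes M :: "real ^ 'n ^ 'm" and b :: "real ^ 'n"
  assumes e: "0 \<le> e" "e < 1" and b: "norm b = 1"
  shows "ennreal ((1 - e\<^sup>2) powr (CARD('m) / 2) * (1 - e\<^sup>2) powr (CARD('n) / 2) * exp (e\<^sup>2 * norm (M *v b)))
       \<le> (\<integral>\<^sup>+u. (\<integral>\<^sup>+v. ennreal (exp (u \<bullet> (M *v v))) \<partial>sphere_unif TYPE('n)) \<partial>sphere_unif TYPE('m))"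
proof -
  define Cm where "Cm = (1 - e\<^sup>2) powr (CARD('m) / 2)"
  define Cn where "Cn = (1 - e\<^sup>2) powr (CARD('n) / 2)"
  have "1 - e\<^sup>2 > 0" using e by (simp add: abs_square_less_1)
  then have "Cm > 0" "Cn > 0" by (simp_all add: Cm_def Cn_def)
  have e': "\<bar>e\<bar> < 1" using e by simp
  have inner: "ennreal (Cn * exp (e * (u \<bullet> (M *v b))))
      \<le> (\<integral>\<^sup>+v. ennreal (exp (u \<bullet> (M *v v))) \<partial>sphere_unif TYPE('n))" for u :: "real ^ 'm"
  proof -
    have transpose: "u \<bullet> (M *v v) = v \<bullet> (transpose M *v u)" for v
      by (simp add: dot_lmul_matrix[symmetric] inner_commute)
    have "u \<bullet> (M *v b) \<le> norm b * norm (transpose M *v u)"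
      unfolding transpose by (rule Cauchy_Schwarz_ineq2[THEN abs_le_D1])
    then have "ennreal (Cn * exp (e * (u \<bullet> (M *v b)))) \<le> ennreal (Cn * exp (e * norm (transpose M *v u)))"
      using b e \<open>Cn > 0\<close> by (intro ennreal_leI) (simp add: mult_left_mono)
    also have "\<dots> \<le> (\<integral>\<^sup>+v. ennreal (exp (v \<bullet> (transpose M *v u))) \<partial>sphere_unif TYPE('n))"
      unfolding Cn_def by (rule nn_integral_sphere_unif_exp_inner_ge[OF e'])
    finally show ?thesis by (simp add: transpose)
  qed
  have "ennreal (Cm * Cn * exp (e\<^sup>2 * norm (M *v b)))
      = ennreal Cn * ennreal (Cm * exp (e * norm (e *\<^sub>R (M *v b))))"
    using e \<open>Cm > 0\<close> \<open>Cn > 0\<close> by (simp add: ennreal_mult[symmetric] power2_eq_square mult_ac)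
  also have "\<dots> \<le> ennreal Cn * (\<integral>\<^sup>+u. ennreal (exp (u \<bullet> (e *\<^sub>R (M *v b)))) \<partial>sphere_unif TYPE('m))"
    unfolding Cm_def by (intro mult_left_mono nn_integral_sphere_unif_exp_inner_ge e') simp
  also have "\<dots> = (\<integral>\<^sup>+u. ennreal (Cn * exp (e * (u \<bullet> (M *v b)))) \<partial>sphere_unif TYPE('m))"
    using \<open>Cn > 0\<close> by (subst nn_integral_cmult[symmetric]) (auto simp: ennreal_mult)
  also have "\<dots> \<le> (\<integral>\<^sup>+u. (\<integral>\<^sup>+v. ennreal (exp (u \<bullet> (M *v v))) \<partial>sphere_unif TYPE('n)) \<partial>sphere_unif TYPE('m))"
    by (intro nn_integral_mono inner)
  finally show ?thesis by (simp add: Cm_def Cn_def)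
qed

lemma Phi_ge_unit:
  fixes M :: "real ^ 'n ^ 'm" and b :: "real ^ 'n"
  assumes "\<bar>\<epsilon>\<bar> < 1" and "norm b = 1"
  shows "(1 - \<epsilon>\<^sup>2) powr ((real CARD('m) + real CARD('n)) / 2) * exp (\<epsilon>\<^sup>2 * norm (M *v b)) \<le> Phi M"
proof -
  have "1 - \<epsilon>\<^sup>2 > 0" using assms(1) by (simp add: abs_square_less_1)
  then have "(1 - \<epsilon>\<^sup>2) powr ((real CARD('m) + real CARD('n)) / 2)
      = (1 - \<bar>\<epsilon>\<bar>\<^sup>2) powr (CARD('m) / 2) * (1 - \<bar>\<epsilon>\<bar>\<^sup>2) powr (CARD('n) / 2)"
    by (simp add: powr_add[symmetric] add_divide_distrib)
  moreover have "(\<integral>\<^sup>+u. (\<integral>\<^sup>+v. ennreal (exp (u \<bullet> (M *v v))) \<partial>sphere_unif TYPE('n)) \<partial>sphere_unif TYPE('m)) < \<top>"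
    using nn_integral_sphere_unif_exp_bilinear_le[of M] by (simp add: le_less_trans[OF _ ennreal_less_top])
  ultimately show ?thesis
    using enn2real_mono[OF nn_integral_sphere_unif_exp_bilinear_ge[of "\<bar>\<epsilon>\<bar>" b M]] assms
    by (simp add: Phi_eq_nn_integral)
qed

lemma onorm_le_of_unit:
  fixes f :: "'a::{real_normed_vector, perfect_space} \<Rightarrow> 'b::real_normed_vector"
  assumes "linear f" and "\<And>x. norm x = 1 \<Longrightarrow> norm (f x) \<le> L"
  shows "onorm f \<le> L"
proof (rule onorm_le)
  fix x :: 'a
  show "norm (f x) \<le> L * norm x"
  proof (cases "x = 0")
    case False
    then have "norm (f (x /\<^sub>R norm x)) \<le> L" by (intro assms(2)) simp
    then show ?thesis
      using False by (simp add: linear_cmul[OF assms(1)] field_simps)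
  qed (simp add: linear_0[OF assms(1)])
qed

lemma exp_onorm_le_of_unit:
  fixes f :: "'a::euclidean_space \<Rightarrow> 'b::real_normed_vector"
  assumes "linear f" and "C > 0" and "c > 0"
    and bound: "\<And>x. norm x = 1 \<Longrightarrow> C * exp (c * norm (f x)) \<le> P"
  shows "C * exp (c * onorm f) \<le> P"
proof -
  obtain b :: 'a where "norm b = 1" using vector_choose_size[of 1] by auto
  then have "P > 0"
    using bound \<open>C > 0\<close> by (meson exp_gt_zero less_le_trans mult_pos_pos)
  define L where "L = ln (P / C) / c"
  have "norm (f x) \<le> L" if "norm x = 1" for x
  proof -
    have "exp (c * norm (f x)) \<le> P / C"
      using bound[OF that] \<open>C > 0\<close> by (simp add: le_divide_eq mult.commute)
    then have "c * norm (f x) \<le> ln (P / C)"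
      using \<open>C > 0\<close> \<open>P > 0\<close> by (simp add: ln_ge_iff)
    then show ?thesis
      using \<open>c > 0\<close> by (simp add: L_def pos_le_divide_eq mult.commute)
  qed
  then have "onorm f \<le> L"
    by (rule onorm_le_of_unit[OF assms(1)])
  then have "C * exp (c * onorm f) \<le> C * exp (c * L)"
    using \<open>C > 0\<close> \<open>c > 0\<close> by (simp add: mult_left_mono)
  also have "\<dots> = P"
    using \<open>C > 0\<close> \<open>c > 0\<close> \<open>P > 0\<close> by (simp add: L_def)
  finally show ?thesis .
qed

theorem lemma2:
  fixes A :: "real ^ 'n ^ 'm" and lam :: real and eps :: real
  assumes "0 < eps" and "eps < 1"
  shows "Phi (lam *\<^sub>R A) \<ge>
           (1 - eps\<^sup>2) powr ((real CARD('m) + real CARD('n)) / 2)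
             * exp (eps\<^sup>2 * onorm (\<lambda>v. (lam *\<^sub>R A) *v v))"
proof -
  have eps: "\<bar>eps\<bar> < 1" using assms by simp
  then have "1 - eps\<^sup>2 > 0" by (simp add: abs_square_less_1)
  then have "(1 - eps\<^sup>2) powr ((real CARD('m) + real CARD('n)) / 2) * exp (eps\<^sup>2 * onorm ((*v) (lam *\<^sub>R A)))
      \<le> Phi (lam *\<^sub>R A)"
    using assms Phi_ge_unit[OF eps]
    by (intro exp_onorm_le_of_unit matrix_vector_mul_linear) simp_all
  then show ?thesis by (simp add: eta_contract_eq)
qed

end
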